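(* Let $(\Omega,\mu)$ be a finite probability space and let $f\colon\Omega^n\to\{0,1\}$ with $\mathbb{E}[f]>0$. Let $r>1$ and let $d$ be a nonnegative integer with $d\le\frac14\log(1/\mathbb{E}[f])$. Suppose $\mathbb{E}[f_{S\to x}]\le r^{|S|}\mathbb{E}[f]$ for all $S\subseteq[n]$ with $|S|\le d$ and all $x\in\Omega^S$. Then \[\|f^{=d}\|_2^2\le \mathbb{E}[f]^2\left(\frac{2200\,r^2\log(1/\mathbb{E}[f])}{d}\right)^d.\]
   Context: Expectations and norms are with respect to the product measure $\mu^n$; $\log$ is natural; the convention $(\cdot)^0=1$ is used (so the bound for $d=0$ reads $\mathbb{E}[f]^2$). $f_{S\to x}(y)=f(x,y)$ denotes restriction, and $\mathbb{E}[f_{S\to x}]$ is its expectation over the remaining coordinates. For $i\in[n]$ let $E_i$ be the operator averaging over coordinate $i$ (i.e. $E_if(x)=\mathbb{E}_{y_i\sim\mu}f(x_1,\dots,y_i,\dots,x_n)$) and $L_i=I-E_i$; for $S\subseteq[n]$, $E_S=\prod_{i\in S}E_i$, $L_S=\prod_{i\in S}L_i$. The Efron–Stein components are $f^{=T}=E_{[n]\setminus T}L_Tf$, and $f^{=d}=\sum_{|T|=d}f^{=T}$. *)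

theory Defs
  imports Main "HOL-Library.FuncSet" Complex_Main
begin

definition fin_prob_space :: "'a set \<Rightarrow> ('a \<Rightarrow> real) \<Rightarrow> bool" where
  "fin_prob_space Om mu \<longleftrightarrow> finite Om \<and> Om \<noteq> {} \<and> (\<forall>a\<in>Om. 0 \<le> mu a) \<and> sum mu Om = 1"

definition cube :: "'a set \<Rightarrow> nat set \<Rightarrow> (nat \<Rightarrow> 'a) set" where
  "cube Om S = PiE S (\<lambda>_. Om)"

definition expect :: "'a set \<Rightarrow> ('a \<Rightarrow> real) \<Rightarrow> nat \<Rightarrow> ((nat \<Rightarrow> 'a) \<Rightarrow> real) \<Rightarrow> real" where
  "expect Om mu n g = (\<Sum>x\<in>cube Om {..<n}. (\<Prod>i<n. mu (x i)) * g x)"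

definition restr_expect :: "'a set \<Rightarrow> ('a \<Rightarrow> real) \<Rightarrow> nat \<Rightarrow> ((nat \<Rightarrow> 'a) \<Rightarrow> real)
    \<Rightarrow> nat set \<Rightarrow> (nat \<Rightarrow> 'a) \<Rightarrow> real" where
  "restr_expect Om mu n f S x =
     (\<Sum>y\<in>cube Om ({..<n} - S). (\<Prod>i\<in>{..<n} - S. mu (y i)) *
        f (\<lambda>i. if i \<in> S then x i else y i))"

definition Eop :: "'a set \<Rightarrow> ('a \<Rightarrow> real) \<Rightarrow> nat \<Rightarrow> ((nat \<Rightarrow> 'a) \<Rightarrow> real) \<Rightarrow> ((nat \<Rightarrow> 'a) \<Rightarrow> real)" where
  "Eop Om mu i g = (\<lambda>x. \<Sum>y\<in>Om. mu y * g (x(i := y)))"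

definition Lop :: "'a set \<Rightarrow> ('a \<Rightarrow> real) \<Rightarrow> nat \<Rightarrow> ((nat \<Rightarrow> 'a) \<Rightarrow> real) \<Rightarrow> ((nat \<Rightarrow> 'a) \<Rightarrow> real)" where
  "Lop Om mu i g = (\<lambda>x. g x - Eop Om mu i g x)"

text \<open>Products of operators over a finite set S of coordinates (the factors commute).\<close>
definition EopS :: "'a set \<Rightarrow> ('a \<Rightarrow> real) \<Rightarrow> nat set \<Rightarrow> ((nat \<Rightarrow> 'a) \<Rightarrow> real) \<Rightarrow> ((nat \<Rightarrow> 'a) \<Rightarrow> real)" where
  "EopS Om mu S = foldr (\<lambda>i h. Eop Om mu i \<circ> h) (sorted_list_of_set S) id"

definition LopS :: "'a set \<Rightarrow> ('a \<Rightarrow> real) \<Rightarrow> nat set \<Rightarrow> ((nat \<Rightarrow> 'a) \<Rightarrow> real) \<Rightarrow> ((nat \<Rightarrow> 'a) \<Rightarrow> real)" where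
  "LopS Om mu S = foldr (\<lambda>i h. Lop Om mu i \<circ> h) (sorted_list_of_set S) id"

definition es_comp :: "'a set \<Rightarrow> ('a \<Rightarrow> real) \<Rightarrow> nat \<Rightarrow> ((nat \<Rightarrow> 'a) \<Rightarrow> real) \<Rightarrow> nat set \<Rightarrow> ((nat \<Rightarrow> 'a) \<Rightarrow> real)" where
  "es_comp Om mu n f T = EopS Om mu ({..<n} - T) (LopS Om mu T f)"

definition es_level :: "'a set \<Rightarrow> ('a \<Rightarrow> real) \<Rightarrow> nat \<Rightarrow> ((nat \<Rightarrow> 'a) \<Rightarrow> real) \<Rightarrow> nat \<Rightarrow> ((nat \<Rightarrow> 'a) \<Rightarrow> real)" where
  "es_level Om mu n f d = (\<lambda>x. \<Sum>T\<in>{T. T \<subseteq> {..<n} \<and> card T = d}. es_comp Om mu n f T x)"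

definition norm2sq :: "'a set \<Rightarrow> ('a \<Rightarrow> real) \<Rightarrow> nat \<Rightarrow> ((nat \<Rightarrow> 'a) \<Rightarrow> real) \<Rightarrow> real" where
  "norm2sq Om mu n g = expect Om mu n (\<lambda>x. (g x)^2)"

end

(* Work with a function f on a product of coordinates N whose Laplacians L_S f satisfy
   ||L_S f||_1 <= R^|S| g and ||L_S f||_2^2 <= R^(2|S|) g^2 e^l on every fibre over S. Unlike the
   class of Boolean global functions, this class is stable under f -> L_S f (with g -> R^|S| g),
   so the level inequality can be proved by strong induction on d.

   Let X = ||f^{=d}||_2^2 = <f, f^{=d}>. Hoelder's inequality interpolated between L^1 and L^2 gives
   X^(2m) <= g^(2m) e^l ||f^{=d}||_(2m)^(2m) with m about l/(2d). Hypercontractivity bounds the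
   2m-th moment by the sum over S of B^|S| s^(m(d-|S|)) E_S (V_S)^m, where V_S is the level d-|S|
   weight of L_S f on the fibres over S, s = 6m and B = (4m^2)^m. For nonempty S the induction
   hypothesis bounds V_S; if X exceeded the claimed bound, all V_S would be small compared with X,
   and the resulting inequality bounds X after all.

   Hypercontractivity is proved one coordinate at a time from an inequality for
   E |a + Y|^(2m) with E Y = 0 in a weighted l^2 space: splitting off coordinate j either puts
   (E_j h, sqrt s L_j h) inside the l^2 norm or takes the 2m-th moment of L_j h. *)
theory Submission
  imports Defs "HOL-Analysis.Convex"
begin

section \<open>Inequalities for finite weighted sums\<close>

text \<open>Each induction step multiplies by \<open>a + p\<close>, which is nonnegative even when
  \<open>p < 0\<close>. The remainder stays quadratic in \<open>p\<close> because
  \<open>a ^ (k + 1)\<close> and \<open>(a + p) * M ^ k\<close> are both at most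
  \<open>M ^ (k + 1)\<close>.\<close>

lemma power_taylor_le:
  fixes a p M :: real
  assumes "0 \<le> a" "0 \<le> a + p" "a \<le> M" "a + p \<le> M"
  shows "(a + p) ^ (k + 2) \<le> a ^ (k + 2) + real (k + 2) * p * a ^ (k + 1)
           + real ((k + 2) * (k + 1)) / 2 * p\<^sup>2 * M ^ k"
proof (induction k)
  case 0
  show ?case by (simp add: power2_eq_square algebra_simps)
next
  case (Suc k)
  have M: "0 \<le> M" using assms by linarith
  have a: "a ^ (k + 1) \<le> M ^ (k + 1)" using assms by (intro power_mono) auto
  have ap: "(a + p) * M ^ k \<le> M ^ (k + 1)" using assms M by (simp add: mult_right_mono)
  have "(a + p) ^ (Suc k + 2) = (a + p) * (a + p) ^ (k + 2)" by simp
  also have "\<dots> \<le> (a + p) * (a ^ (k + 2) + real (k + 2) * p * a ^ (k + 1)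
      + real ((k + 2) * (k + 1)) / 2 * p\<^sup>2 * M ^ k)"
    using assms by (intro mult_left_mono Suc.IH) auto
  also have "\<dots> = a ^ (k + 3) + real (k + 3) * p * a ^ (k + 2) + real (k + 2) * p\<^sup>2 * a ^ (k + 1)
      + real ((k + 2) * (k + 1)) / 2 * p\<^sup>2 * ((a + p) * M ^ k)"
    by (simp add: power2_eq_square numeral_3_eq_3 algebra_simps)
  also have "\<dots> \<le> a ^ (k + 3) + real (k + 3) * p * a ^ (k + 2) + real (k + 2) * p\<^sup>2 * M ^ (k + 1)
      + real ((k + 2) * (k + 1)) / 2 * p\<^sup>2 * M ^ (k + 1)"
    using a ap by (intro add_mono order.refl mult_left_mono) auto
  also have "\<dots> = a ^ (Suc k + 2) + real (Suc k + 2) * p * a ^ (Suc k + 1)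
      + real ((Suc k + 2) * (Suc k + 1)) / 2 * p\<^sup>2 * M ^ Suc k"
    by (simp add: numeral_3_eq_3 field_simps)
  finally show ?case .
qed

lemma power_add_ge:
  fixes a b :: real
  assumes "0 \<le> a" "0 \<le> b"
  shows "a ^ Suc k + real (Suc k) * a ^ k * b \<le> (a + b) ^ Suc k"
proof (induction k)
  case (Suc k)
  have "a ^ Suc (Suc k) + real (Suc (Suc k)) * a ^ Suc k * b
      \<le> (a + b) * (a ^ Suc k + real (Suc k) * a ^ k * b)"
    using assms by (simp add: algebra_simps)
  also have "\<dots> \<le> (a + b) * (a + b) ^ Suc k"
    using assms by (intro mult_left_mono Suc.IH) auto
  finally show ?case by simp
qed simp

lemma one_plus_power_le_3:
  assumes "(t::real) \<ge> 0" "real n * t \<le> 1"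
  shows "(1 + t) ^ n \<le> 3"
proof -
  have "(1 + t) ^ n \<le> exp t ^ n"
    using assms exp_ge_add_one_self[of t] by (intro power_mono) auto
  also have "\<dots> = exp (real n * t)" by (simp add: exp_of_nat_mult)
  also have "\<dots> \<le> exp 1" using assms by simp
  also have "\<dots> \<le> 3" using exp_le by simp
  finally show ?thesis .
qed

lemma perturbed_power_le:
  fixes A t c :: real
  assumes A: "0 \<le> A" and t: "0 \<le> t" and c: "\<bar>c\<bar> \<le> A * t" and m: "m = k + 2"
  shows "(A\<^sup>2 + 2 * c + t\<^sup>2) ^ m \<le> (A\<^sup>2) ^ m + 2 * real m * c * (A\<^sup>2) ^ (m - 1)
           + real m * (A\<^sup>2) ^ (m - 1) * (6 * real m * t\<^sup>2) + (4 * real m ^ 2) ^ m * (t\<^sup>2) ^ m"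
proof -
  \<comment> \<open>Second-order Taylor bound; the remainder is absorbed by the term quadratic in \<open>t\<close> when
    \<open>t\<close> is at most about \<open>A / (2 * m)\<close>, and by the term in \<open>t ^ (2 * m)\<close> otherwise.\<close>
  define p where "p = 2 * c + t\<^sup>2"
  define M where "M = (A + t)\<^sup>2"
  have M0: "0 \<le> M" and AM: "A\<^sup>2 \<le> M"
    using A t by (auto simp: M_def power2_eq_square algebra_simps)
  have low: "0 \<le> A\<^sup>2 + p"
  proof -
    have "0 \<le> (A - t)\<^sup>2" by simp
    also have "\<dots> \<le> A\<^sup>2 + p" using c by (simp add: p_def power2_eq_square algebra_simps abs_le_iff)
    finally show ?thesis .
  qed
  have up: "A\<^sup>2 + p \<le> M"
    using c by (simp add: p_def M_def power2_eq_square algebra_simps abs_le_iff)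
  have p2: "p\<^sup>2 \<le> 4 * t\<^sup>2 * M"
  proof -
    have "\<bar>p\<bar> \<le> t * (2 * A + t)"
    proof -
      have "0 \<le> A * t" using A t by simp
      moreover have "t * (2 * A + t) = 2 * (A * t) + t\<^sup>2" by (simp add: power2_eq_square algebra_simps)
      ultimately show ?thesis
        using c zero_le_power2[of t] unfolding p_def by linarith
    qed
    also have "\<dots> \<le> t * (2 * (A + t))"
      using t A by (intro mult_left_mono) auto
    finally have "\<bar>p\<bar>\<^sup>2 \<le> (t * (2 * (A + t)))\<^sup>2"
      by (intro power_mono) auto
    then show ?thesis by (simp add: M_def power_mult_distrib del: distrib_left_numeral)
  qed
  have "(A\<^sup>2 + p) ^ m \<le> (A\<^sup>2) ^ m + real m * p * (A\<^sup>2) ^ (m - 1)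
      + real (m * (m - 1)) / 2 * p\<^sup>2 * M ^ k"
    using power_taylor_le[of "A\<^sup>2" p M k] low up AM by (simp add: m)
  also have "real (m * (m - 1)) / 2 * p\<^sup>2 * M ^ k \<le> real (m * (m - 1)) / 2 * (4 * t\<^sup>2 * M) * M ^ k"
    using M0 by (intro mult_left_mono mult_right_mono p2) auto
  also have "\<dots> = 2 * real m * (real m - 1) * t\<^sup>2 * M ^ (m - 1)"
    by (simp add: m field_simps)
  also have "real m * p * (A\<^sup>2) ^ (m - 1) =
      2 * real m * c * (A\<^sup>2) ^ (m - 1) + real m * t\<^sup>2 * (A\<^sup>2) ^ (m - 1)"
    by (simp add: p_def algebra_simps)
  also have "real m * t\<^sup>2 * (A\<^sup>2) ^ (m - 1) \<le> real m * t\<^sup>2 * M ^ (m - 1)"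
    using AM by (intro mult_left_mono power_mono) auto
  finally have main: "(A\<^sup>2 + p) ^ m \<le> (A\<^sup>2) ^ m + 2 * real m * c * (A\<^sup>2) ^ (m - 1) +
      real m * (2 * real m - 1) * t\<^sup>2 * M ^ (m - 1)"
    by (simp add: algebra_simps)
  have "real m * (2 * real m - 1) * t\<^sup>2 * M ^ (m - 1) \<le>
      real m * (A\<^sup>2) ^ (m - 1) * (6 * real m * t\<^sup>2) + (4 * real m ^ 2) ^ m * (t\<^sup>2) ^ m"
  proof (cases "2 * real m * t \<le> A + t")
    case True
    \<comment> \<open>Here (2 m - 1) t <= A, so passing from A to A + t costs at most a factor e in
      the power 2 (m - 1). This 3, times the 2 m that bounds 2 m - 1, is the constant 6 m. If A = 0,
      then also t = 0.\<close>
    have "M ^ (m - 1) \<le> 3 * (A\<^sup>2) ^ (m - 1)"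
    proof (cases "A = 0")
      case True
      with \<open>2 * real m * t \<le> A + t\<close> have "(2 * real m - 1) * t \<le> 0" by (simp add: algebra_simps)
      moreover have "2 * real m - 1 > 0" by (simp add: m)
      ultimately have "t = 0" using t by (simp add: mult_le_0_iff)
      with True show ?thesis by (simp add: M_def m)
    next
      case False
      then have A0: "A > 0" using A by simp
      have "M ^ (m - 1) = (A + t) ^ (2 * (m - 1))" by (simp add: M_def power_mult)
      also have "A + t = A * (1 + t / A)" using A0 by (simp add: field_simps)
      also have "\<dots> ^ (2 * (m - 1)) = A ^ (2 * (m - 1)) * (1 + t / A) ^ (2 * (m - 1))"
        by (rule power_mult_distrib)
      also have "\<dots> \<le> A ^ (2 * (m - 1)) * 3"
      proof (intro mult_left_mono one_plus_power_le_3)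
        have "real (2 * (m - 1)) * t \<le> A"
          using True t by (simp add: m algebra_simps)
        then show "real (2 * (m - 1)) * (t / A) \<le> 1" using A0 by (simp add: field_simps)
      qed (use A t in auto)
      finally show ?thesis by (simp add: power_mult)
    qed
    then have "real m * (2 * real m - 1) * t\<^sup>2 * M ^ (m - 1) \<le>
        real m * (2 * real m - 1) * t\<^sup>2 * (3 * (A\<^sup>2) ^ (m - 1))"
      by (intro mult_left_mono) (auto simp: m)
    also have "\<dots> \<le> real m * (2 * real m) * t\<^sup>2 * (3 * (A\<^sup>2) ^ (m - 1))"
      by (intro mult_right_mono mult_left_mono) auto
    also have "\<dots> = real m * (A\<^sup>2) ^ (m - 1) * (6 * real m * t\<^sup>2)" by simp
    also have "\<dots> \<le> \<dots> + (4 * real m ^ 2) ^ m * (t\<^sup>2) ^ m" by simp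
    finally show ?thesis .
  next
    case False
    \<comment> \<open>Now A + t < 2 m t, so M is controlled by t alone; this is the origin of the
      factor 4 m^2.\<close>
    have "M \<le> (2 * real m * t)\<^sup>2"
      unfolding M_def using False A t by (intro power_mono) auto
    then have "M ^ (m - 1) \<le> (4 * real m ^ 2 * t\<^sup>2) ^ (m - 1)"
      using M0 by (intro power_mono) (auto simp: power_mult_distrib)
    then have "real m * (2 * real m - 1) * t\<^sup>2 * M ^ (m - 1) \<le>
        real m * (2 * real m - 1) * t\<^sup>2 * (4 * real m ^ 2 * t\<^sup>2) ^ (m - 1)"
      by (intro mult_left_mono) (auto simp: m)
    also have "\<dots> \<le> (4 * real m ^ 2) * t\<^sup>2 * (4 * real m ^ 2 * t\<^sup>2) ^ (m - 1)"
      using t by (intro mult_right_mono zero_le_power) (auto simp: power2_eq_square algebra_simps)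
    also have "\<dots> = (4 * real m ^ 2 * t\<^sup>2) ^ m"
      by (subst (3) power_minus_mult[symmetric]) (simp_all add: m)
    also have "\<dots> = (4 * real m ^ 2) ^ m * (t\<^sup>2) ^ m"
      by (rule power_mult_distrib)
    also have "\<dots> \<le> real m * (A\<^sup>2) ^ (m - 1) * (6 * real m * t\<^sup>2) + \<dots>" by simp
    finally show ?thesis .
  qed
  then show ?thesis using main by (simp add: p_def add.assoc)
qed

section \<open>Weighted moment inequalities\<close>

lemma weighted_Cauchy_Schwarz:
  fixes w :: "'z \<Rightarrow> real"
  assumes "\<And>z. z \<in> Z \<Longrightarrow> 0 \<le> w z"
  shows "(\<Sum>z\<in>Z. w z * f z * g z)\<^sup>2 \<le> (\<Sum>z\<in>Z. w z * (f z)\<^sup>2) * (\<Sum>z\<in>Z. w z * (g z)\<^sup>2)"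
proof -
  have "(\<Sum>z\<in>Z. w z * f z * g z) = (\<Sum>z\<in>Z. (sqrt (w z) * f z) * (sqrt (w z) * g z))"
  proof (intro sum.cong refl)
    fix z assume "z \<in> Z"
    then have "sqrt (w z) * sqrt (w z) = w z" using assms by simp
    then show "w z * f z * g z = (sqrt (w z) * f z) * (sqrt (w z) * g z)"
      by (metis mult.assoc mult.left_commute)
  qed
  also have "\<dots>\<^sup>2 \<le> (\<Sum>z\<in>Z. (sqrt (w z) * f z)\<^sup>2) * (\<Sum>z\<in>Z. (sqrt (w z) * g z)\<^sup>2)"
    by (rule Cauchy_Schwarz_ineq_sum)
  also have "\<dots> = (\<Sum>z\<in>Z. w z * (f z)\<^sup>2) * (\<Sum>z\<in>Z. w z * (g z)\<^sup>2)"
    using assms by (simp add: power_mult_distrib)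
  finally show ?thesis .
qed

text \<open>The sums over \<open>Z\<close> are squared norms in a weighted l^2 space. Cauchy-Schwarz
  makes \<open>perturbed_power_le\<close> apply for each \<open>y\<close>, with A and t the norms of
  \<open>a\<close> and \<open>Y y\<close> and c their inner product. Averaging over \<open>y\<close>
  kills the term linear in c, and \<open>power_add_ge\<close> moves the 6 m term inside the m-th
  power.\<close>

lemma one_coordinate:
  fixes mu :: "'a \<Rightarrow> real" and w a :: "'z \<Rightarrow> real" and Y :: "'a \<Rightarrow> 'z \<Rightarrow> real"
  assumes mu: "\<And>y. y \<in> Om \<Longrightarrow> 0 \<le> mu y" "sum mu Om = 1"
    and w: "\<And>z. z \<in> Z \<Longrightarrow> 0 \<le> w z"
    and mean: "\<And>z. z \<in> Z \<Longrightarrow> (\<Sum>y\<in>Om. mu y * Y y z) = 0"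
    and m: "2 \<le> m"
  shows "(\<Sum>y\<in>Om. mu y * (\<Sum>z\<in>Z. w z * (a z + Y y z)\<^sup>2) ^ m)
    \<le> ((\<Sum>z\<in>Z. w z * (a z)\<^sup>2) + 6 * real m * (\<Sum>y\<in>Om. mu y * (\<Sum>z\<in>Z. w z * (Y y z)\<^sup>2))) ^ m
      + (4 * real m ^ 2) ^ m * (\<Sum>y\<in>Om. mu y * (\<Sum>z\<in>Z. w z * (Y y z)\<^sup>2) ^ m)"
proof -
  obtain k where k: "m = k + 2" using m by (metis add.commute le_Suc_ex)
  define \<alpha> where "\<alpha> = (\<Sum>z\<in>Z. w z * (a z)\<^sup>2)"
  define \<tau> where "\<tau> y = (\<Sum>z\<in>Z. w z * (Y y z)\<^sup>2)" for y
  define c where "c y = (\<Sum>z\<in>Z. w z * a z * Y y z)" for y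
  have \<alpha>0: "0 \<le> \<alpha>" and \<tau>0: "0 \<le> \<tau> y" for y
    unfolding \<alpha>_def \<tau>_def using w by (auto intro!: sum_nonneg)
  have expand: "(\<Sum>z\<in>Z. w z * (a z + Y y z)\<^sup>2) = \<alpha> + 2 * c y + \<tau> y" for y
    unfolding \<alpha>_def \<tau>_def c_def
    by (simp add: power2_eq_square algebra_simps sum.distrib sum_distrib_left)
  have c_mean: "(\<Sum>y\<in>Om. mu y * c y) = 0"
  proof -
    have "(\<Sum>y\<in>Om. mu y * c y) = (\<Sum>z\<in>Z. w z * a z * (\<Sum>y\<in>Om. mu y * Y y z))"
      unfolding c_def sum_distrib_left
      by (subst sum.swap) (simp add: mult.left_commute mult.assoc)
    then show ?thesis using mean by simp
  qed
  have pt: "(\<alpha> + 2 * c y + \<tau> y) ^ m \<le> \<alpha> ^ m + 2 * real m * c y * \<alpha> ^ (m - 1)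
      + real m * \<alpha> ^ (m - 1) * (6 * real m * \<tau> y) + (4 * real m ^ 2) ^ m * \<tau> y ^ m" for y
  proof -
    have "(c y)\<^sup>2 \<le> \<alpha> * \<tau> y"
      unfolding c_def \<alpha>_def \<tau>_def using w by (rule weighted_Cauchy_Schwarz)
    then have "\<bar>c y\<bar> \<le> sqrt \<alpha> * sqrt (\<tau> y)"
      by (metis real_sqrt_abs real_sqrt_le_iff real_sqrt_mult)
    from perturbed_power_le[OF _ _ this k] show ?thesis using \<alpha>0 \<tau>0 by simp
  qed
  have "(\<Sum>y\<in>Om. mu y * (\<alpha> + 2 * c y + \<tau> y) ^ m) \<le>
      (\<Sum>y\<in>Om. mu y * (\<alpha> ^ m + 2 * real m * c y * \<alpha> ^ (m - 1)
      + real m * \<alpha> ^ (m - 1) * (6 * real m * \<tau> y) + (4 * real m ^ 2) ^ m * \<tau> y ^ m))"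
    using mu by (intro sum_mono mult_left_mono pt) auto
  also have "\<dots> = sum mu Om * \<alpha> ^ m + 2 * real m * \<alpha> ^ (m - 1) * (\<Sum>y\<in>Om. mu y * c y) +
      real m * \<alpha> ^ (m - 1) * (6 * real m * (\<Sum>y\<in>Om. mu y * \<tau> y)) +
      (4 * real m ^ 2) ^ m * (\<Sum>y\<in>Om. mu y * \<tau> y ^ m)"
    by (simp add: sum_distrib_left sum_distrib_right algebra_simps sum.distrib)
  also have "\<dots> = \<alpha> ^ m + real m * \<alpha> ^ (m - 1) * (6 * real m * (\<Sum>y\<in>Om. mu y * \<tau> y)) +
      (4 * real m ^ 2) ^ m * (\<Sum>y\<in>Om. mu y * \<tau> y ^ m)"
    using c_mean mu by simp
  also have "\<alpha> ^ m + real m * \<alpha> ^ (m - 1) * (6 * real m * (\<Sum>y\<in>Om. mu y * \<tau> y)) \<le>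
      (\<alpha> + 6 * real m * (\<Sum>y\<in>Om. mu y * \<tau> y)) ^ m"
    using power_add_ge[of \<alpha> "6 * real m * (\<Sum>y\<in>Om. mu y * \<tau> y)" "k + 1"] \<alpha>0 \<tau>0 mu
    by (simp add: k sum_nonneg)
  finally show ?thesis unfolding expand \<alpha>_def[symmetric] \<tau>_def[symmetric] by simp
qed

text \<open>Jensen's inequality for the convex function x^(k+1) on the nonnegative reals, with the
  weights normalised by their sum. Total weight zero is treated apart, since it cannot be
  normalised.\<close>

lemma weighted_power_mean:
  fixes p :: "'z \<Rightarrow> real"
  assumes "finite Z" "\<And>z. z \<in> Z \<Longrightarrow> 0 \<le> p z" "\<And>z. z \<in> Z \<Longrightarrow> 0 \<le> g z"
  shows "(\<Sum>z\<in>Z. p z * g z) ^ Suc k \<le> (\<Sum>z\<in>Z. p z) ^ k * (\<Sum>z\<in>Z. p z * g z ^ Suc k)"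
proof (cases "sum p Z = 0")
  case True
  then have "\<forall>z\<in>Z. p z = 0" using assms by (simp add: sum_nonneg_eq_0_iff)
  then show ?thesis by simp
next
  case False
  define s where "s = sum p Z"
  have s: "s > 0" using False assms(2) by (simp add: s_def order_less_le sum_nonneg)
  have conv: "convex_on {0::real..} (\<lambda>x. x ^ Suc k)"
    using convex_power_odd[of "Suc k"] convex_on_subset[OF convex_power_even[of "Suc k"], of "{0..}"]
    by (cases "even (Suc k)") (auto simp del: power_Suc)
  have ne: "Z \<noteq> {}" using False by auto
  have "(\<Sum>z\<in>Z. (p z / s) *\<^sub>R g z) ^ Suc k \<le> (\<Sum>z\<in>Z. (p z / s) * g z ^ Suc k)"
    using assms s False
    by (intro convex_on_sum[OF assms(1) ne conv]) (auto simp: s_def simp flip: sum_divide_distrib)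
  then have "((\<Sum>z\<in>Z. p z * g z) / s) ^ Suc k \<le> (\<Sum>z\<in>Z. p z * g z ^ Suc k) / s"
    by (simp add: sum_divide_distrib)
  then have "(\<Sum>z\<in>Z. p z * g z) ^ Suc k \<le> (\<Sum>z\<in>Z. p z * g z ^ Suc k) / s * s ^ Suc k"
    using s by (simp only: power_divide) (simp add: field_simps)
  also have "\<dots> = s ^ k * (\<Sum>z\<in>Z. p z * g z ^ Suc k)"
    using s by simp
  finally show ?thesis by (simp add: s_def)
qed

text \<open>First the power mean inequality with weights \<open>w z * \<bar>f z\<bar>\<close>, which
  produces the L^1 norm of \<open>f\<close>; then Cauchy-Schwarz separates \<open>f\<close> from the
  power of \<open>g\<close>.\<close>

lemma interpolated_Hoelder:
  fixes w f g :: "'z \<Rightarrow> real"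
  assumes "finite Z" "\<And>z. z \<in> Z \<Longrightarrow> 0 \<le> w z"
  shows "(\<Sum>z\<in>Z. w z * (f z * g z)) ^ (2 * Suc k) \<le>
     (\<Sum>z\<in>Z. w z * \<bar>f z\<bar>) ^ (2 * k) * ((\<Sum>z\<in>Z. w z * (f z)\<^sup>2) * (\<Sum>z\<in>Z. w z * (g z) ^ (2 * Suc k)))"
proof -
  define X where "X = (\<Sum>z\<in>Z. w z * \<bar>f z\<bar> * \<bar>g z\<bar>)"
  have X: "\<bar>\<Sum>z\<in>Z. w z * (f z * g z)\<bar> \<le> X"
    unfolding X_def using assms
    by (intro order.trans[OF sum_abs] sum_mono) (simp add: abs_mult)
  have "(\<Sum>z\<in>Z. w z * (f z * g z)) ^ (2 * Suc k) = \<bar>\<Sum>z\<in>Z. w z * (f z * g z)\<bar> ^ (2 * Suc k)"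
    by (simp add: power_even_abs)
  also have "\<dots> \<le> X ^ (2 * Suc k)"
    using X by (intro power_mono) auto
  also have "\<dots> = (X ^ Suc k)\<^sup>2" by (metis power_mult mult.commute)
  also have "\<dots> \<le> ((\<Sum>z\<in>Z. w z * \<bar>f z\<bar>) ^ k * (\<Sum>z\<in>Z. w z * \<bar>f z\<bar> * \<bar>g z\<bar> ^ Suc k))\<^sup>2"
    unfolding X_def using assms
    by (intro power_mono weighted_power_mean zero_le_power sum_nonneg mult_nonneg_nonneg) auto
  also have "\<dots> = (\<Sum>z\<in>Z. w z * \<bar>f z\<bar>) ^ (2 * k) * (\<Sum>z\<in>Z. w z * \<bar>f z\<bar> * \<bar>g z\<bar> ^ Suc k)\<^sup>2"
    by (simp add: power_mult_distrib power_mult mult.commute)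
  also have "(\<Sum>z\<in>Z. w z * \<bar>f z\<bar> * \<bar>g z\<bar> ^ Suc k)\<^sup>2 \<le>
      (\<Sum>z\<in>Z. w z * \<bar>f z\<bar>\<^sup>2) * (\<Sum>z\<in>Z. w z * (\<bar>g z\<bar> ^ Suc k)\<^sup>2)"
    using assms by (intro weighted_Cauchy_Schwarz) auto
  also have "(\<Sum>z\<in>Z. w z * (\<bar>g z\<bar> ^ Suc k)\<^sup>2) = (\<Sum>z\<in>Z. w z * (g z) ^ (2 * Suc k))"
    by (simp add: power_mult[symmetric] mult.commute[of _ 2] power_even_abs del: power_Suc mult_Suc_right)
  finally show ?thesis
    using assms by (simp add: mult_left_mono)
qed

section \<open>Numerical estimates for the induction over levels\<close>

lemma sum_Pow_powers:
  fixes a b :: "'b :: comm_semiring_1"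
  assumes "finite T"
  shows "(\<Sum>S\<in>Pow T. a ^ card S * b ^ (card T - card S)) = (a + b) ^ card T"
proof -
  have "(a + b) ^ card T = (\<Sum>S\<in>Pow T. a ^ card S * b ^ card (T - S))"
    using prod_add[OF assms, of "\<lambda>_. a" "\<lambda>_. b"] by simp
  also have "\<dots> = (\<Sum>S\<in>Pow T. a ^ card S * b ^ (card T - card S))"
    using finite_subset[OF _ assms] by (intro sum.cong refl) (simp add: card_Diff_subset)
  finally show ?thesis ..
qed

text \<open>For \<open>k = d\<close> the junk value \<open>l / 0 = 0\<close> is harmless because of \<open>0 ^ 0 = 1\<close>.\<close>
lemma shifted_level_bound:
  fixes R l g :: real and d k :: nat
  assumes "k \<le> d" "d > 0" "l > 0" "R \<ge> 1"
  shows "(R ^ k * g)\<^sup>2 * (550 * R\<^sup>2 * l / real (d - k)) ^ (d - k) \<le>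
    g\<^sup>2 * (550 * R\<^sup>2 * l / real d) ^ d * (3 * real d / (550 * l)) ^ k"
proof -
  define z where "z = 550 * R\<^sup>2 * l / real d"
  have z: "z > 0" using assms by (simp add: z_def)
  \<comment> \<open>With j = d - k, the quotient d / j = 1 + k / j is at most exp (k / j), so its
    j-th power is at most e^k.\<close>
  have ratio: "(real d / real (d - k)) ^ (d - k) \<le> 3 ^ k"
  proof (cases "k = d")
    case False
    then have j: "real (d - k) > 0" using assms by simp
    have "real d / real (d - k) = 1 + real k / real (d - k)"
      using assms False by (simp add: field_simps of_nat_diff)
    also have "\<dots> \<le> exp (real k / real (d - k))" by (rule exp_ge_add_one_self)
    finally have "(real d / real (d - k)) ^ (d - k) \<le> exp (real k / real (d - k)) ^ (d - k)"
      by (intro power_mono) auto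
    also have "\<dots> = exp 1 ^ k" using j by (simp flip: exp_of_nat_mult)
    also have "\<dots> \<le> 3 ^ k" using exp_le by (intro power_mono) auto
    finally show ?thesis .
  qed simp
  have "550 * R\<^sup>2 * l / real (d - k) = z * (real d / real (d - k))"
    using assms by (simp add: z_def)
  then have "(R ^ k * g)\<^sup>2 * (550 * R\<^sup>2 * l / real (d - k)) ^ (d - k) =
      (R ^ k * g)\<^sup>2 * (z ^ (d - k) * (real d / real (d - k)) ^ (d - k))"
    by (simp only: power_mult_distrib)
  also have "\<dots> \<le> (R ^ k * g)\<^sup>2 * (z ^ (d - k) * 3 ^ k)"
    using z by (intro mult_left_mono ratio) auto
  also have "\<dots> = g\<^sup>2 * z ^ d * (3 * R\<^sup>2 / z) ^ k"
    using z assms by (simp add: power_mult_distrib power_divide power_diff power_mult[symmetric] mult.commute)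
  \<comment> \<open>The \<open>R\<^sup>2\<close> inside \<open>z\<close> cancels the growth of
    \<open>g\<close> to \<open>R ^ k * g\<close>, so the gain per removed coordinate does not depend
    on \<open>R\<close>.\<close>
  also have "3 * R\<^sup>2 / z = 3 * real d / (550 * l)"
    using assms by (simp add: z_def)
  finally show ?thesis by (simp add: z_def)
qed

text \<open>The choice of m makes l comparable to d m: 2 d m <= l <= 3 d m. Hence the bracket is at
  most (12 m)^m and exp l at most 27^(d m). Cancelling X^m and taking m-th roots leaves (27 * 12 *
  m)^d, and m <= l / (2 d) turns 324 m into 162 l / d.\<close>

lemma moment_self_bound:
  fixes X g l :: real and m d :: nat
  assumes m: "2 \<le> m" "real m \<le> l / (2 * real d)" "l / (2 * real d) < real m + 1"
    and d: "d > 0" and X: "X > 0" and g: "0 \<le> g" and l: "l > 0"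
    and le: "X ^ (2 * m) \<le> g ^ (2 * m) * exp l * (X ^ m *
       ((4 * real m ^ 2) ^ m * (3 * real d / (550 * l)) ^ (m - 1) + (6 * real m) ^ m) ^ d)"
  shows "X \<le> g\<^sup>2 * (162 * l / real d) ^ d"
proof -
  define \<rho> where "\<rho> = 3 * real d / (550 * l)"
  define Y where "Y = (4 * real m ^ 2) ^ m * \<rho> ^ (m - 1) + (6 * real m) ^ m"
  have \<rho>0: "0 \<le> \<rho>" using l by (simp add: \<rho>_def)
  have ml: "2 * real d * real m \<le> l" using m d by (simp add: field_simps)
  have lm: "l \<le> 3 * real d * real m"
  proof -
    have "l < (real m + 1) * (2 * real d)" using m(3) d by (simp add: field_simps)
    also have "\<dots> \<le> (real m * 3 / 2) * (2 * real d)"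
      using m(1) by (intro mult_right_mono) auto
    finally show ?thesis by (simp add: mult_ac)
  qed
  have \<rho>m: "4 * (real m)\<^sup>2 * \<rho> \<le> real m"
  proof -
    have "4 * (real m)\<^sup>2 * (3 * real d) \<le> real m * (550 * (2 * real d * real m))"
      by (simp add: power2_eq_square)
    also have "\<dots> \<le> real m * (550 * l)"
      using ml by (intro mult_left_mono) auto
    finally show ?thesis using l by (simp add: \<rho>_def field_simps)
  qed
  \<comment> \<open>The exponent of \<rho> is only m - 1, so one factor 4 m^2 is left unmatched; the
    surplus 4 m is absorbed by 6^m.\<close>
  have "(4 * real m ^ 2) ^ m * \<rho> ^ (m - 1) = 4 * real m ^ 2 * (4 * (real m)\<^sup>2 * \<rho>) ^ (m - 1)"
    using m by (cases m) (auto simp: power_mult_distrib)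
  also have "\<dots> \<le> 4 * real m ^ 2 * real m ^ (m - 1)"
    using \<rho>m \<rho>0 by (intro mult_left_mono power_mono) auto
  also have "\<dots> = (4 * real m) * real m ^ m"
    using m by (cases m) (auto simp: power2_eq_square)
  also have "\<dots> \<le> 6 ^ m * real m ^ m"
  proof (intro mult_right_mono)
    have "1 + real m * 5 \<le> (1 + 5) ^ m" by (rule Bernoulli_inequality) simp
    then show "4 * real m \<le> 6 ^ m" by simp
  qed simp
  finally have "Y \<le> 2 * (6 * real m) ^ m"
    unfolding Y_def power_mult_distrib[of 6 "real m" m] by linarith
  also have "\<dots> \<le> 2 ^ m * (6 * real m) ^ m"
    using m self_le_power[of "2::real" m] by (intro mult_right_mono) auto
  also have "\<dots> = (12 * real m) ^ m" by (subst power_mult_distrib[symmetric]) simp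
  finally have Y: "Y \<le> (12 * real m) ^ m" .
  have Y0: "0 \<le> Y" using \<rho>0 by (simp add: Y_def)
  have el: "exp l \<le> (27 ^ d) ^ m"
  proof -
    have "exp l \<le> exp (real (3 * d * m) * 1)" using lm by simp
    also have "\<dots> = exp 1 ^ (3 * d * m)" by (rule exp_of_nat_mult)
    also have "\<dots> \<le> 3 ^ (3 * d * m)" using exp_le by (intro power_mono) auto
    also have "\<dots> = (27 ^ d) ^ m" by (simp add: power_mult)
    finally show ?thesis .
  qed
  have "X ^ m * X ^ m \<le> (g ^ (2 * m) * exp l * Y ^ d) * X ^ m"
    using le unfolding Y_def \<rho>_def mult_2[of m] power_add[of X m m] by (simp only: mult_ac)
  then have "X ^ m \<le> g ^ (2 * m) * exp l * Y ^ d"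
    using X by simp
  also have "\<dots> \<le> g ^ (2 * m) * (27 ^ d) ^ m * ((12 * real m) ^ m) ^ d"
    using el Y Y0 g by (intro mult_mono power_mono mult_left_mono) auto
  also have "\<dots> = (g\<^sup>2 * (27 * (12 * real m)) ^ d) ^ m"
  proof -
    have "g ^ (2 * m) * (27 ^ d) ^ m * (z ^ m) ^ d = (g\<^sup>2 * (27 * z) ^ d) ^ m" for z :: real
      by (simp only: power_mult_distrib power_mult[symmetric] mult.commute[of d m] mult.assoc)
    then show ?thesis .
  qed
  finally have "X \<le> g\<^sup>2 * (27 * (12 * real m)) ^ d"
    using m by (subst (asm) power_mono_iff) (use X in auto)
  also have "\<dots> \<le> g\<^sup>2 * (162 * l / real d) ^ d"
    using m d by (intro mult_left_mono power_mono) (auto simp: field_simps)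
  finally show ?thesis .
qed

section \<open>Averaging operators\<close>

text \<open>The ambient set \<open>I\<close> stays fixed while the induction works on subsets
  \<open>N\<close> of it. Coordinates in \<open>I - N\<close> are frozen parameters, read off the
  base point.\<close>

locale product_space =
  fixes Om :: "'a set" and mu :: "'a \<Rightarrow> real" and I :: "nat set"
  assumes prob: "fin_prob_space Om mu" and fin_I: "finite I"
begin

abbreviation C where "C \<equiv> cube Om I"

abbreviation E where "E \<equiv> Eop Om mu"

definition wt :: "nat set \<Rightarrow> (nat \<Rightarrow> 'a) \<Rightarrow> real" where
  "wt S y = (\<Prod>i\<in>S. mu (y i))"

text \<open>Averages are functions of the full point that ignore the coordinates in \<open>S\<close>, so that
  restricting a function to a fibre is the same as evaluating at a point.\<close>
definition A :: "nat set \<Rightarrow> ((nat \<Rightarrow> 'a) \<Rightarrow> real) \<Rightarrow> (nat \<Rightarrow> 'a) \<Rightarrow> real" where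
  "A S g x = (\<Sum>y\<in>cube Om S. wt S y * g (override_on x y S))"

text \<open>The product of the operators I - E_i over \<open>S\<close>, multiplied out. In this form
  no order of the factors is involved, and commutation with averages follows from linearity.\<close>

definition L :: "nat set \<Rightarrow> ((nat \<Rightarrow> 'a) \<Rightarrow> real) \<Rightarrow> (nat \<Rightarrow> 'a) \<Rightarrow> real" where
  "L S g x = (\<Sum>U\<in>Pow S. (-1) ^ card U * A U g x)"

text \<open>The coordinate set \<open>N\<close> is a parameter because the induction passes to
  components over \<open>N - S\<close>.\<close>

definition P :: "nat set \<Rightarrow> nat set \<Rightarrow> ((nat \<Rightarrow> 'a) \<Rightarrow> real) \<Rightarrow> (nat \<Rightarrow> 'a) \<Rightarrow> real" where
  "P N T f = A (N - T) (L T f)"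

lemma fin_Om: "finite Om" and Om_ne: "Om \<noteq> {}" and mu_nonneg: "a \<in> Om \<Longrightarrow> 0 \<le> mu a"
  and mu_sum: "sum mu Om = 1"
  using prob by (auto simp: fin_prob_space_def)

lemma finite_cube: "finite S \<Longrightarrow> finite (cube Om S)"
  unfolding cube_def by (intro finite_PiE) (auto simp: fin_Om)

lemma wt_nonneg: "y \<in> cube Om S \<Longrightarrow> 0 \<le> wt S y"
  unfolding wt_def cube_def by (intro prod_nonneg) (auto intro: mu_nonneg)

lemma override_in_C: "S \<subseteq> I \<Longrightarrow> x \<in> C \<Longrightarrow> y \<in> cube Om S \<Longrightarrow> override_on x y S \<in> C"
  by (auto simp: cube_def override_on_def PiE_def Pi_def extensional_def)

lemma E_idem: "E i (E i g) = E i g"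
  unfolding Eop_def by (rule ext) (simp add: sum_distrib_right[symmetric] mu_sum)

lemma E_sum: "E i (\<lambda>x. \<Sum>j\<in>J. c j * g j x) = (\<lambda>x. \<Sum>j\<in>J. c j * E i (g j) x)"
  unfolding Eop_def
  by (rule ext, simp add: sum_distrib_left, subst sum.swap, simp add: mult.left_commute)

lemma E_diff: "E i (\<lambda>x. g x - h x) = (\<lambda>x. E i g x - E i h x)"
  by (simp add: Eop_def algebra_simps sum_subtractf)

lemma A_empty [simp]: "A {} g = g"
  by (rule ext) (simp add: A_def cube_def wt_def)

text \<open>Fubini: a point over \<open>insert i S\<close> is a point over \<open>S\<close> together
  with a value at \<open>i\<close>.\<close>

lemma A_insert:
  assumes "finite S" "i \<notin> S"
  shows "A (insert i S) g = E i (A S g)"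
proof
  fix x
  have "A (insert i S) g x = (\<Sum>(a, y)\<in>Om \<times> cube Om S. wt (insert i S) (y(i := a)) *
      g (override_on x (y(i := a)) (insert i S)))"
    unfolding A_def cube_def PiE_insert_eq
    using inj_combinator[OF assms(2), of "\<lambda>_. Om"]
    by (subst sum.reindex) (auto simp: case_prod_unfold)
  also have "\<dots> = (\<Sum>(a, y)\<in>Om \<times> cube Om S. mu a * (wt S y * g (override_on (x(i := a)) y S)))"
  proof (intro sum.cong refl, clarify)
    fix a y
    assume "a \<in> Om" "y \<in> cube Om S"
    have 1: "wt (insert i S) (y(i := a)) = mu a * wt S y"
      using assms by (auto simp: wt_def intro!: prod.cong)
    have 2: "override_on x (y(i := a)) (insert i S) = override_on (x(i := a)) y S"
      using assms by (auto simp: override_on_def fun_eq_iff)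
    show "wt (insert i S) (y(i := a)) * g (override_on x (y(i := a)) (insert i S)) =
        mu a * (wt S y * g (override_on (x(i := a)) y S))"
      unfolding 1 2 by simp
  qed
  also have "\<dots> = E i (A S g) x"
    by (simp add: Eop_def A_def sum.cartesian_product[symmetric] sum_distrib_left)
  finally show "A (insert i S) g x = E i (A S g) x" .
qed

lemma E_A: "finite S \<Longrightarrow> E i (A S g) = A (insert i S) g"
proof (cases "i \<in> S")
  case True
  assume "finite S"
  then have "A S g = E i (A (S - {i}) g)"
    using A_insert[of "S - {i}" i g] True by (simp add: insert_absorb)
  then show ?thesis
    using True by (simp add: E_idem insert_absorb)
qed (simp add: A_insert)

lemma A_A: "finite S \<Longrightarrow> finite T \<Longrightarrow> A S (A T g) = A (S \<union> T) g"
  by (induction S rule: finite_induct) (auto simp: A_insert E_A)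

lemma A_sum: "A S (\<lambda>x. \<Sum>j\<in>J. c j * g j x) = (\<lambda>x. \<Sum>j\<in>J. c j * A S (g j) x)"
  unfolding A_def
  by (rule ext, simp add: sum_distrib_left, subst sum.swap, simp add: mult.left_commute)

lemma A_sum': "A S (\<lambda>x. \<Sum>j\<in>J. g j x) = (\<lambda>x. \<Sum>j\<in>J. A S (g j) x)"
  using A_sum[of S "\<lambda>_. 1"] by simp

lemma A_cmult: "A S (\<lambda>x. c * g x) = (\<lambda>x. c * A S g x)"
  by (rule ext) (simp add: A_def sum_distrib_left mult.left_commute)

lemma A_add: "A S (\<lambda>x. g x + h x) = (\<lambda>x. A S g x + A S h x)"
  by (rule ext) (simp add: A_def algebra_simps sum.distrib)

lemma A_zero: "A S (\<lambda>_. 0) = (\<lambda>_. 0)"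
  by (rule ext) (simp add: A_def)

lemma A_const: "finite S \<Longrightarrow> A S (\<lambda>_. c) = (\<lambda>_. c)"
proof (induction S rule: finite_induct)
  case (insert i S)
  then show ?case
    by (simp add: A_insert Eop_def mu_sum sum_distrib_right[symmetric])
qed simp

lemma A_mono:
  assumes "S \<subseteq> I" "x \<in> C" "\<And>z. z \<in> C \<Longrightarrow> g z \<le> h z"
  shows "A S g x \<le> A S h x"
  unfolding A_def using assms
  by (intro sum_mono mult_left_mono wt_nonneg) (auto intro: override_in_C)

lemma A_nonneg: "S \<subseteq> I \<Longrightarrow> x \<in> C \<Longrightarrow> (\<And>z. z \<in> C \<Longrightarrow> 0 \<le> g z) \<Longrightarrow> 0 \<le> A S g x"
  using A_mono[of S x "\<lambda>_. 0" g] by (simp add: A_zero)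

lemma A_abs:
  assumes "S \<subseteq> I" "x \<in> C"
  shows "\<bar>A S g x\<bar> \<le> A S (\<lambda>z. \<bar>g z\<bar>) x"
proof -
  have "A S g x \<le> A S (\<lambda>z. \<bar>g z\<bar>) x" using assms by (intro A_mono) auto
  moreover have "A S (\<lambda>z. - 1 * g z) x \<le> A S (\<lambda>z. \<bar>g z\<bar>) x" using assms by (intro A_mono) auto
  ultimately show ?thesis by (simp only: A_cmult abs_le_iff) simp
qed

lemma A_override: "A S k (override_on x y S) = A S k x"
proof -
  have "override_on (override_on x y S) z S = override_on x z S" for z
    by (auto simp: override_on_def)
  then show ?thesis by (simp add: A_def)
qed

text \<open>An average over \<open>S\<close> ignores the coordinates in \<open>S\<close>, so it acts
  as a constant under another average over \<open>S\<close>.\<close>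

lemma A_mult_fixed: "A S (\<lambda>x. A S k x * g x) = (\<lambda>x. A S k x * A S g x)"
  unfolding A_def[of S "\<lambda>x. A S k x * g x"] A_override
  by (rule ext) (simp add: A_def[of S g] sum_distrib_left mult.left_commute)

lemma E_eq_A: "E i = A {i}"
  using A_insert[of "{}" i] by auto

section \<open>Laplacians\<close>

lemma L_insert:
  assumes "finite S" "i \<notin> S"
  shows "L (insert i S) g = (\<lambda>x. L S g x - E i (L S g) x)"
proof
  fix x
  have inj: "inj_on (insert i) (Pow S)"
    using assms(2) by (auto simp: inj_on_def)
  have "L (insert i S) g x = L S g x + (\<Sum>U\<in>insert i ` Pow S. (-1) ^ card U * A U g x)"
    unfolding L_def Pow_insert using assms by (subst sum.union_disjoint) auto
  also have "(\<Sum>U\<in>insert i ` Pow S. (-1) ^ card U * A U g x) =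
      (\<Sum>U\<in>Pow S. - ((-1) ^ card U * E i (A U g) x))"
    unfolding sum.reindex[OF inj] o_def
  proof (intro sum.cong refl)
    fix U assume "U \<in> Pow S"
    then have "finite U" "i \<notin> U" using assms finite_subset by auto
    then show "(-1) ^ card (insert i U) * A (insert i U) g x = - ((-1) ^ card U * E i (A U g) x)"
      by (simp add: A_insert)
  qed
  also have "\<dots> = - E i (L S g) x"
    unfolding L_def[abs_def] E_sum by (simp add: sum_negf)
  finally show "L (insert i S) g x = L S g x - E i (L S g) x" by simp
qed

lemma L_empty [simp]: "L {} g = g"
  by (rule ext) (simp add: L_def)

lemma L_singleton: "L {i} g = (\<lambda>x. g x - E i g x)"
  using L_insert[of "{}" i g] by simp

lemma A_L: "finite S \<Longrightarrow> finite T \<Longrightarrow> A T (L S g) = L S (A T g)"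
  unfolding L_def[abs_def] A_sum
  by (intro ext sum.cong refl) (metis A_A Pow_iff finite_subset Un_commute)

lemma L_zero: "L S (\<lambda>_. 0) = (\<lambda>_. 0)"
  by (rule ext) (simp add: L_def A_zero)

lemma E_L_zero:
  assumes "finite S" "i \<in> S"
  shows "E i (L S g) = (\<lambda>_. 0)"
proof -
  have "L S g = (\<lambda>x. L (S - {i}) g x - E i (L (S - {i}) g) x)"
    using L_insert[of "S - {i}" i g] assms by (simp add: insert_absorb)
  then show ?thesis by (simp add: E_diff E_idem)
qed

lemma A_E:
  assumes "finite T" "i \<in> T"
  shows "A T g = A T (E i g)"
  using A_A[of T "{i}" g] assms by (simp add: E_eq_A insert_absorb)

lemma A_L_zero:
  assumes "finite S" "finite T" "i \<in> S" "i \<in> T"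
  shows "A T (L S g) = (\<lambda>_. 0)"
  using assms by (subst A_E[of T i]) (simp_all add: E_L_zero A_zero)

lemma L_L: "finite S \<Longrightarrow> finite T \<Longrightarrow> S \<inter> T = {} \<Longrightarrow> L S (L T g) = L (S \<union> T) g"
  by (induction S rule: finite_induct) (auto simp: L_insert)

lemma L_fixed: "finite S \<Longrightarrow> (\<And>i. i \<in> S \<Longrightarrow> E i u = (\<lambda>_. 0)) \<Longrightarrow> L S u = u"
  by (induction S rule: finite_induct) (auto simp: L_insert)

section \<open>Efron--Stein components\<close>

lemma L_absorb:
  assumes "finite T"
  shows "L T (L T g) = L T g"
  using assms by (intro L_fixed) (simp_all add: E_L_zero)

text \<open>Some coordinate lies in exactly one of the two sets. There one operator averages and the
  other applies I - E_i, and these factors annihilate each other.\<close>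

lemma P_P_distinct:
  assumes N: "finite N" "T \<subseteq> N" "T' \<subseteq> N" and ne: "T \<noteq> T'"
  shows "P N T (P N T' f) = (\<lambda>_. 0)"
proof -
  have fin: "finite T" "finite T'" using N finite_subset by auto
  consider i where "i \<in> T'" "i \<in> N - T" | i where "i \<in> T" "i \<in> N - T'"
    using ne N by blast
  then show ?thesis
  proof cases
    case 1
    have "P N T (P N T' f) = L T (A ((N - T) \<union> (N - T')) (L T' f))"
      using N fin by (simp add: P_def A_L A_A)
    also have "A ((N - T) \<union> (N - T')) (L T' f) = (\<lambda>_. 0)"
      using N fin 1 by (intro A_L_zero[of _ _ i]) auto
    finally show ?thesis by (simp add: L_zero)
  next
    case 2
    have "P N T (P N T' f) = A ((N - T) \<union> (N - T')) (L T (L T' f))"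
      using N fin by (simp add: P_def A_A flip: A_L)
    also have "\<dots> = (\<lambda>_. 0)"
      using N fin 2 by (intro A_L_zero[of _ _ i]) auto
    finally show ?thesis .
  qed
qed

lemma P_absorb:
  assumes "finite N" "T \<subseteq> N"
  shows "P N T (P N T f) = P N T f"
proof -
  have fin: "finite T" using assms finite_subset by auto
  have "P N T (P N T f) = A ((N - T) \<union> (N - T)) (L T (L T f))"
    using assms fin by (simp add: P_def A_A flip: A_L)
  then show ?thesis using fin by (simp add: P_def L_absorb)
qed

lemma A_P_zero:
  assumes "finite N" "T \<subseteq> N" "U \<subseteq> N" "i \<in> U" "i \<in> T"
  shows "A U (P N T f) = (\<lambda>_. 0)"
proof -
  have fin: "finite T" "finite U" using assms finite_subset by auto
  have "A U (P N T f) = A (U \<union> (N - T)) (L T f)"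
    using assms fin by (simp add: P_def A_A)
  then show ?thesis using assms fin by (simp add: A_L_zero[of _ _ i])
qed

text \<open>Averaging over \<open>U\<close> first pulls out \<open>A U h\<close> and kills the
  component, which has mean zero in the coordinate \<open>i\<close>. Orthogonality of components is
  a special case.\<close>

lemma A_mult_P_zero:
  assumes "finite N" "T \<subseteq> N" "U \<subseteq> N" "i \<in> U" "i \<in> T"
  shows "A N (\<lambda>x. A U h x * P N T f x) = (\<lambda>_. 0)"
proof -
  have fin: "finite U" using assms finite_subset by auto
  have "A N (\<lambda>x. A U h x * P N T f x) = A N (A U (\<lambda>x. A U h x * P N T f x))"
    using assms fin by (simp add: A_A Un_absorb2)
  also have "\<dots> = (\<lambda>_. 0)"
    unfolding A_mult_fixed A_P_zero[OF assms] by (simp add: A_zero)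
  finally show ?thesis .
qed

lemma P_orthogonal:
  assumes N: "finite N" "T \<subseteq> N" "T' \<subseteq> N" and ne: "T \<noteq> T'"
  shows "A N (\<lambda>x. P N T f x * P N T' g x) = (\<lambda>_. 0)"
proof -
  consider i where "i \<in> T'" "i \<in> N - T" | i where "i \<in> T" "i \<in> N - T'"
    using ne N by blast
  then show ?thesis
  proof cases
    case 1
    then show ?thesis
      using A_mult_P_zero[of N T' "N - T" i "L T f" g] N by (simp add: P_def)
  next
    case 2
    then show ?thesis
      using A_mult_P_zero[of N T "N - T'" i "L T' g" f] N by (simp add: P_def mult.commute)
  qed
qed

text \<open>On the left, averaging over \<open>N - T\<close> first replaces \<open>f\<close> by
  \<open>h\<close>. On the right, one factor \<open>u\<close> is expanded as \<open>L T h\<close>;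
  by \<open>A_mult_P_zero\<close> only the term for the empty set survives, which is again the
  pairing of \<open>h\<close> with \<open>u\<close>.\<close>

lemma A_mult_P:
  assumes "finite N" "T \<subseteq> N"
  shows "A N (\<lambda>x. f x * P N T f x) = A N (\<lambda>x. (P N T f x)\<^sup>2)"
proof -
  have fin: "finite T" using assms finite_subset by auto
  define h where "h = A (N - T) f"
  define u where "u = P N T f"
  have u_L: "u = L T h" using assms fin by (simp add: u_def h_def P_def A_L)
  have "A N (\<lambda>x. f x * u x) = A N (A (N - T) (\<lambda>x. A (N - T) (L T f) x * f x))"
    using assms by (simp add: A_A u_def P_def mult.commute Un_absorb2)
  also have "\<dots> = A N (\<lambda>x. h x * u x)"
    unfolding A_mult_fixed by (simp add: u_def P_def h_def mult.commute)
  finally have 1: "A N (\<lambda>x. f x * u x) = A N (\<lambda>x. h x * u x)" .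
  have "A N (\<lambda>x. (u x)\<^sup>2) = A N (\<lambda>x. \<Sum>U\<in>Pow T. (-1) ^ card U * (A U h x * u x))"
  proof -
    have "(u x)\<^sup>2 = (\<Sum>U\<in>Pow T. (-1) ^ card U * (A U h x * u x))" for x
    proof -
      have "(u x)\<^sup>2 = L T h x * u x" by (simp add: u_L power2_eq_square)
      then show ?thesis by (simp add: L_def sum_distrib_right mult.assoc)
    qed
    then show ?thesis by simp
  qed
  also have "\<dots> = (\<lambda>x. \<Sum>U\<in>Pow T. (-1) ^ card U * A N (\<lambda>x. A U h x * u x) x)"
    by (rule A_sum)
  also have "\<dots> = (\<lambda>x. \<Sum>U\<in>{{}}. (-1) ^ card U * A N (\<lambda>x. A U h x * u x) x)"
  proof (intro ext sum.mono_neutral_right ballI)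
    fix x U assume "U \<in> Pow T - {{}}"
    then obtain i where "i \<in> U" "U \<subseteq> T" by auto
    moreover from this have "U \<subseteq> N" "i \<in> T" using assms by auto
    ultimately show "(-1) ^ card U * A N (\<lambda>x. A U h x * u x) x = 0"
      using A_mult_P_zero[of N T U i h f] assms by (auto simp: u_def)
  qed (use fin in auto)
  finally show ?thesis using 1 by (simp add: u_def)
qed

section \<open>Weights of the levels\<close>

definition level :: "nat set \<Rightarrow> nat \<Rightarrow> nat set set" where
  "level N d = {T. T \<subseteq> N \<and> card T = d}"

lemma finite_level: "finite N \<Longrightarrow> finite (level N d)"
  by (simp add: level_def)

text \<open>A function rather than a number: it still depends on the coordinates outside
  \<open>N\<close>, so it gives the level weight on every fibre.\<close>

definition D :: "nat set \<Rightarrow> nat \<Rightarrow> ((nat \<Rightarrow> 'a) \<Rightarrow> real) \<Rightarrow> (nat \<Rightarrow> 'a) \<Rightarrow> real" where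
  "D N d f = A N (\<lambda>x. (\<Sum>T\<in>level N d. P N T f x)\<^sup>2)"

lemma D_eq_sum:
  assumes "finite N"
  shows "D N d f = (\<lambda>x. \<Sum>T\<in>level N d. A N (\<lambda>x. (P N T f x)\<^sup>2) x)"
proof -
  have "D N d f = (\<lambda>x. \<Sum>T\<in>level N d. \<Sum>T'\<in>level N d. A N (\<lambda>x. P N T f x * P N T' f x) x)"
    by (simp add: D_def power2_eq_square sum_product A_sum')
  also have "\<dots> = (\<lambda>x. \<Sum>T\<in>level N d. \<Sum>T'\<in>level N d. if T' = T then A N (\<lambda>x. (P N T f x)\<^sup>2) x else 0)"
  proof (intro ext sum.cong refl)
    fix x T T' assume "T \<in> level N d" "T' \<in> level N d"
    then show "A N (\<lambda>x. P N T f x * P N T' f x) x = (if T' = T then A N (\<lambda>x. (P N T f x)\<^sup>2) x else 0)"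
      using P_orthogonal[OF assms, of T T' f f] by (auto simp: level_def power2_eq_square)
  qed
  also have "\<dots> = (\<lambda>x. \<Sum>T\<in>level N d. A N (\<lambda>x. (P N T f x)\<^sup>2) x)"
    using finite_level[OF assms] by (simp add: sum.delta')
  finally show ?thesis .
qed

text \<open>This pairing with \<open>f\<close> is what Hoelder's inequality is applied to.\<close>

lemma D_eq_inner:
  assumes "finite N"
  shows "D N d f = A N (\<lambda>x. f x * (\<Sum>T\<in>level N d. P N T f x))"
proof -
  have "A N (\<lambda>x. f x * (\<Sum>T\<in>level N d. P N T f x)) =
      (\<lambda>x. \<Sum>T\<in>level N d. A N (\<lambda>x. f x * P N T f x) x)"
    by (simp add: sum_distrib_left A_sum')
  then show ?thesis
    using assms by (auto simp: D_eq_sum A_mult_P level_def intro!: sum.cong)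
qed

section \<open>Hypercontractivity\<close>

text \<open>The squared norm, over the coordinates in \<open>J - S\<close>, of \<open>L S h\<close> after scaling its component at
  \<open>U\<close> by \<open>sqrt s ^ card U\<close>.\<close>
definition Q :: "real \<Rightarrow> nat set \<Rightarrow> nat set \<Rightarrow> ((nat \<Rightarrow> 'a) \<Rightarrow> real) \<Rightarrow> (nat \<Rightarrow> 'a) \<Rightarrow> real" where
  "Q s J S h = A (J - S) (\<lambda>x. \<Sum>U\<in>Pow (J - S). s ^ card U * (L (S \<union> U) (A (J - S - U) h) x)\<^sup>2)"

lemma E_upd: "E j g (z(j := v)) = E j g z"
  by (simp add: Eop_def)

text \<open>This is \<open>one_coordinate\<close> with index set the pairs (U, y) of a subset of
  \<open>K\<close> and a point over \<open>K\<close>. The constant part is E_j of the component, the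
  fluctuation its L_j part at the value \<open>v\<close> of coordinate \<open>j\<close>. The
  fluctuation alone gives \<open>Q\<close> at \<open>insert j S\<close>; the constant part plus s
  times the averaged fluctuation gives \<open>Q\<close> at \<open>S\<close>.\<close>

lemma hypercontractivity_step:
  fixes m :: nat
  assumes J: "finite J" "j \<notin> J" "S \<subseteq> J" and m: "2 \<le> m" and s: "s = 6 * real m"
  shows "E j (\<lambda>x. Q s J S h x ^ m) x \<le> Q s (insert j J) S h x ^ m
     + (4 * real m ^ 2) ^ m * E j (\<lambda>x. Q s (insert j J) (insert j S) h x ^ m) x"
proof -
  define K where "K = J - S"
  define H where "H U = L (S \<union> U) (A (K - U) h)" for U
  define Z where "Z = Pow K \<times> cube Om K"
  define w where "w z = s ^ card (fst z) * wt K (snd z)" for z :: "nat set \<times> (nat \<Rightarrow> 'a)"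
  define a where "a z = E j (H (fst z)) (override_on x (snd z) K)" for z
  define Y where "Y v z = L {j} (H (fst z)) (override_on (x(j := v)) (snd z) K)" for v z
  have K: "finite K" "j \<notin> K" "j \<notin> S" "finite S" using J finite_subset by (auto simp: K_def)
  have s0: "0 \<le> s" by (simp add: s)
  have ov: "override_on (x(j := v)) y K = (override_on x y K)(j := v)" for v y
    using K by (auto simp: override_on_def)
  have AK: "A K (\<lambda>x. \<Sum>U\<in>Pow K. s ^ card U * (F U x)\<^sup>2) x' =
      (\<Sum>z\<in>Z. w z * (F (fst z) (override_on x' (snd z) K))\<^sup>2)" for F x'
  proof -
    have "A K (\<lambda>x. \<Sum>U\<in>Pow K. s ^ card U * (F U x)\<^sup>2) x' = (\<Sum>U\<in>Pow K. \<Sum>y\<in>cube Om K.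
        wt K y * (s ^ card U * (F U (override_on x' y K))\<^sup>2))"
      unfolding A_def sum_distrib_left by (rule sum.swap)
    then show ?thesis
      by (simp add: Z_def w_def sum.cartesian_product case_prod_unfold mult_ac)
  qed
  have Q1: "Q s J S h (x(j := v)) = (\<Sum>z\<in>Z. w z * (a z + Y v z)\<^sup>2)" for v
  proof -
    have "H (fst z) (override_on (x(j := v)) (snd z) K) = a z + Y v z" for z
      by (simp add: a_def Y_def L_singleton ov E_upd)
    then show ?thesis
      unfolding Q_def K_def[symmetric] H_def[symmetric] AK by simp
  qed
  have HU: "L {j} (H U) = L (insert j S \<union> U) (A (K - U) h)" if "U \<in> Pow K" for U
    using that K finite_subset[of U K] L_L[of "{j}" "S \<union> U" "A (K - U) h"] by (auto simp: H_def)
  have Q2: "Q s (insert j J) (insert j S) h (x(j := v)) = (\<Sum>z\<in>Z. w z * (Y v z)\<^sup>2)" for v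
  proof -
    have "insert j J - insert j S = K" using J by (auto simp: K_def)
    then have "Q s (insert j J) (insert j S) h =
        A K (\<lambda>x. \<Sum>U\<in>Pow K. s ^ card U * (L {j} (H U) x)\<^sup>2)"
      by (simp add: Q_def HU)
    then show ?thesis by (simp add: AK Y_def)
  qed
  have Q3: "Q s (insert j J) S h x =
      (\<Sum>z\<in>Z. w z * (a z)\<^sup>2) + 6 * real m * (\<Sum>v\<in>Om. mu v * (\<Sum>z\<in>Z. w z * (Y v z)\<^sup>2))"
  proof -
    have iK: "insert j J - S = insert j K" using J by (auto simp: K_def)
    have inj: "inj_on (insert j) (Pow K)" using K by (auto simp: inj_on_def)
    \<comment> \<open>Sets without \<open>j\<close> have \<open>j\<close> among their averaged
      coordinates, which gives E_j; sets with \<open>j\<close> give L_j and one more factor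
      \<open>s\<close>.\<close>
    have "(\<Sum>U\<in>Pow (insert j K). s ^ card U * (L (S \<union> U) (A (insert j K - U) h) x')\<^sup>2) =
       (\<Sum>U\<in>Pow K. s ^ card U * (E j (H U) x')\<^sup>2) + s * (\<Sum>U\<in>Pow K. s ^ card U * (L {j} (H U) x')\<^sup>2)" for x'
    proof -
      have "(\<Sum>U\<in>Pow (insert j K). s ^ card U * (L (S \<union> U) (A (insert j K - U) h) x')\<^sup>2) =
        (\<Sum>U\<in>Pow K. s ^ card U * (L (S \<union> U) (A (insert j K - U) h) x')\<^sup>2) +
        (\<Sum>U\<in>insert j ` Pow K. s ^ card U * (L (S \<union> U) (A (insert j K - U) h) x')\<^sup>2)"
        unfolding Pow_insert using K by (subst sum.union_disjoint) auto
      also have "(\<Sum>U\<in>Pow K. s ^ card U * (L (S \<union> U) (A (insert j K - U) h) x')\<^sup>2) =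
          (\<Sum>U\<in>Pow K. s ^ card U * (E j (H U) x')\<^sup>2)"
      proof (intro sum.cong refl)
        fix U assume U: "U \<in> Pow K"
        then have "insert j K - U = insert j (K - U)" "finite U" "j \<notin> K - U"
          using K finite_subset by auto
        then show "s ^ card U * (L (S \<union> U) (A (insert j K - U) h) x')\<^sup>2 = s ^ card U * (E j (H U) x')\<^sup>2"
          using K by (simp add: H_def E_eq_A A_L A_A)
      qed
      also have "(\<Sum>U\<in>insert j ` Pow K. s ^ card U * (L (S \<union> U) (A (insert j K - U) h) x')\<^sup>2) =
         s * (\<Sum>U\<in>Pow K. s ^ card U * (L {j} (H U) x')\<^sup>2)"
        unfolding sum.reindex[OF inj] o_def sum_distrib_left
      proof (intro sum.cong refl)
        fix U assume U: "U \<in> Pow K"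
        then have "insert j K - insert j U = K - U" "finite U" "j \<notin> U"
          using K finite_subset by auto
        then show "s ^ card (insert j U) * (L (S \<union> insert j U) (A (insert j K - insert j U) h) x')\<^sup>2 =
            s * (s ^ card U * (L {j} (H U) x')\<^sup>2)"
          using HU[OF U] by simp
      qed
      finally show ?thesis .
    qed
    then have "Q s (insert j J) S h x = E j (A K (\<lambda>x'. (\<Sum>U\<in>Pow K. s ^ card U * (E j (H U) x')\<^sup>2) +
        s * (\<Sum>U\<in>Pow K. s ^ card U * (L {j} (H U) x')\<^sup>2))) x"
      unfolding Q_def iK using K by (simp add: A_insert)
    also have "\<dots> = (\<Sum>v\<in>Om. mu v * ((\<Sum>z\<in>Z. w z * (a z)\<^sup>2) + s * (\<Sum>z\<in>Z. w z * (Y v z)\<^sup>2)))"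
      unfolding A_add A_cmult AK
      by (rule trans[OF fun_cong[OF Eop_def]]) (simp add: a_def Y_def ov E_upd)
    also have "\<dots> = sum mu Om * (\<Sum>z\<in>Z. w z * (a z)\<^sup>2) + s * (\<Sum>v\<in>Om. mu v * (\<Sum>z\<in>Z. w z * (Y v z)\<^sup>2))"
    proof -
      have "(\<Sum>v\<in>Om. mu v * (c + s * F v)) = sum mu Om * c + s * (\<Sum>v\<in>Om. mu v * F v)" for c F
        by (simp add: distrib_left sum.distrib sum_distrib_right sum_distrib_left mult.left_commute)
      then show ?thesis .
    qed
    finally show ?thesis by (simp add: mu_sum s)
  qed
  have mean: "(\<Sum>v\<in>Om. mu v * Y v z) = 0" for z
  proof -
    have "(\<Sum>v\<in>Om. mu v * Y v z) = E j (L {j} (H (fst z))) (override_on x (snd z) K)"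
      by (simp add: Eop_def Y_def ov)
    then show ?thesis by (simp add: E_L_zero)
  qed
  have "0 \<le> w z" if "z \<in> Z" for z
    using that s0 wt_nonneg by (auto simp: w_def Z_def)
  from one_coordinate[where mu = mu and Om = Om and w = w and a = a and Y = Y and Z = Z, OF mu_nonneg mu_sum this mean m]
  show ?thesis
    unfolding Q3 Eop_def Q1 Q2 by simp
qed

text \<open>Adding a coordinate \<open>j\<close> splits the term of each \<open>S\<close> into one
  for \<open>S\<close> and one for \<open>insert j S\<close>, the latter with one more factor B.
  Together these run over all subsets of \<open>insert j J\<close>. For empty \<open>J\<close>,
  \<open>Q\<close> is just the square of \<open>h\<close>.\<close>

lemma hypercontractivity:
  fixes m :: nat
  assumes m: "2 \<le> m" and s: "s = 6 * real m" and "finite J" "J \<subseteq> I" "x \<in> C"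
  shows "A J (\<lambda>x. h x ^ (2 * m)) x \<le> (\<Sum>S\<in>Pow J. ((4 * real m ^ 2) ^ m) ^ card S * A S (\<lambda>x. Q s J S h x ^ m) x)"
  using assms(3-)
proof (induction J arbitrary: x rule: finite_induct)
  case empty
  then show ?case by (simp add: Q_def power_mult)
next
  case (insert j J)
  define B where "B = (4 * real m ^ 2) ^ m"
  have B0: "0 \<le> B" by (simp add: B_def)
  have fin: "finite S" if "S \<in> Pow J" for S using that insert.hyps finite_subset by auto
  have inj: "inj_on (insert j) (Pow J)" using insert.hyps by (auto simp: inj_on_def)
  have "A (insert j J) (\<lambda>x. h x ^ (2 * m)) x = A {j} (A J (\<lambda>x. h x ^ (2 * m))) x"
    using insert.hyps by (simp add: A_A)
  also have "\<dots> \<le> A {j} (\<lambda>x. \<Sum>S\<in>Pow J. B ^ card S * A S (\<lambda>x. Q s J S h x ^ m) x) x"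
    unfolding B_def using insert.prems by (intro A_mono insert.IH) auto
  also have "\<dots> = (\<Sum>S\<in>Pow J. B ^ card S * A S (E j (\<lambda>x. Q s J S h x ^ m)) x)"
    unfolding A_sum using fin by (intro sum.cong refl) (simp add: E_eq_A A_A)
  also have "\<dots> \<le> (\<Sum>S\<in>Pow J. B ^ card S * A S (\<lambda>x. Q s (insert j J) S h x ^ m +
      B * E j (\<lambda>x. Q s (insert j J) (insert j S) h x ^ m) x) x)"
    using insert.hyps insert.prems B0 m s unfolding B_def
    by (intro sum_mono mult_left_mono A_mono hypercontractivity_step) auto
  also have "\<dots> = (\<Sum>S\<in>Pow J. B ^ card S * A S (\<lambda>x. Q s (insert j J) S h x ^ m) x) +
      (\<Sum>S\<in>Pow J. B ^ card (insert j S) * A (insert j S) (\<lambda>x. Q s (insert j J) (insert j S) h x ^ m) x)"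
    unfolding sum.distrib[symmetric]
  proof (intro sum.cong refl)
    fix S assume S: "S \<in> Pow J"
    then have "j \<notin> S" "finite S" using insert.hyps fin by auto
    then show "B ^ card S * A S (\<lambda>x. Q s (insert j J) S h x ^ m +
        B * E j (\<lambda>x. Q s (insert j J) (insert j S) h x ^ m) x) x =
      B ^ card S * A S (\<lambda>x. Q s (insert j J) S h x ^ m) x +
      B ^ card (insert j S) * A (insert j S) (\<lambda>x. Q s (insert j J) (insert j S) h x ^ m) x"
      by (simp add: A_add A_cmult E_eq_A A_A algebra_simps)
  qed
  also have "\<dots> = (\<Sum>S\<in>Pow (insert j J). B ^ card S * A S (\<lambda>x. Q s (insert j J) S h x ^ m) x)"
    unfolding Pow_insert using insert.hyps
    by (subst sum.union_disjoint) (auto simp: sum.reindex[OF inj])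
  finally show ?case unfolding B_def .
qed

section \<open>The level inequality\<close>

lemma L_sum: "L S (\<lambda>x. \<Sum>j\<in>J. g j x) = (\<lambda>x. \<Sum>j\<in>J. L S (g j) x)"
  by (rule ext) (simp add: L_def A_sum' sum_distrib_left sum.swap[of _ "Pow S"])

lemma P_sum: "P N T (\<lambda>x. \<Sum>j\<in>J. g j x) = (\<lambda>x. \<Sum>j\<in>J. P N T (g j) x)"
  by (simp add: P_def L_sum A_sum')

lemma P_level:
  assumes "finite N" "T \<subseteq> N"
  shows "P N T (\<lambda>x. \<Sum>T'\<in>level N d. P N T' f x) = (if card T = d then P N T f else (\<lambda>_. 0))"
proof -
  have "P N T (\<lambda>x. \<Sum>T'\<in>level N d. P N T' f x) = (\<lambda>x. \<Sum>T'\<in>level N d. if T' = T then P N T f x else 0)"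
    unfolding P_sum
  proof (intro ext sum.cong refl)
    fix x T' assume "T' \<in> level N d"
    then show "P N T (P N T' f) x = (if T' = T then P N T f x else 0)"
      using assms P_P_distinct[of N T T' f] P_absorb[of N T f] by (auto simp: level_def)
  qed
  also have "\<dots> = (if card T = d then P N T f else (\<lambda>_. 0))"
    using assms finite_level[of N d] by (auto simp: level_def sum.delta')
  finally show ?thesis .
qed

text \<open>The link behind the induction: components of \<open>f\<close> at sets containing
  \<open>S\<close> are lower components of \<open>L S f\<close> on the fibres over
  \<open>S\<close>.\<close>

lemma P_Un:
  assumes "finite N" "S \<subseteq> N" "U \<subseteq> N - S"
  shows "P N (S \<union> U) f = P (N - S) U (L S f)"
proof -
  have "finite S" "finite U" "U \<inter> S = {}" "N - (S \<union> U) = N - S - U"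
    using assms finite_subset[of S N] finite_subset[of U "N - S"] by auto
  then show ?thesis by (simp add: P_def L_L Un_commute)
qed

text \<open>Only the sets \<open>U\<close> with |S| + |U| = d survive on a function of pure level
  \<open>d\<close>, so the weights in \<open>Q\<close> reduce to a single power of
  \<open>s\<close>.\<close>

lemma Q_level:
  assumes N: "finite N" "S \<subseteq> N"
  shows "Q s N S (\<lambda>x. \<Sum>T\<in>level N d. P N T f x) =
    (if card S \<le> d then (\<lambda>x. s ^ (d - card S) * D (N - S) (d - card S) (L S f) x) else (\<lambda>_. 0))"
proof -
  define g where "g = (\<lambda>x. \<Sum>T\<in>level N d. P N T f x)"
  have fin: "finite S" "finite (N - S)" using N finite_subset by auto
  have comp: "L (S \<union> U) (A (N - S - U) g) =
      (if card S + card U = d then P (N - S) U (L S f) else (\<lambda>_. 0))" if "U \<in> Pow (N - S)" for U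
  proof -
    have U: "finite U" "N - (S \<union> U) = N - S - U" "S \<inter> U = {}"
      using that fin finite_subset by auto
    have "L (S \<union> U) (A (N - S - U) g) = P N (S \<union> U) g"
      using fin U by (simp add: P_def A_L)
    also have "\<dots> = (if card (S \<union> U) = d then P N (S \<union> U) f else (\<lambda>_. 0))"
      unfolding g_def using N that by (intro P_level) auto
    also have "card (S \<union> U) = card S + card U"
      using fin U by (intro card_Un_disjoint)
    finally show ?thesis using N that by (simp add: P_Un)
  qed
  have "(\<Sum>U\<in>Pow (N - S). s ^ card U * (L (S \<union> U) (A (N - S - U) g) x)\<^sup>2) =
     (if card S \<le> d then (\<Sum>U\<in>level (N - S) (d - card S). s ^ (d - card S) * (P (N - S) U (L S f) x)\<^sup>2) else 0)" for x
  proof (cases "card S \<le> d")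
    case True
    have "(\<Sum>U\<in>Pow (N - S). s ^ card U * (L (S \<union> U) (A (N - S - U) g) x)\<^sup>2) =
       (\<Sum>U\<in>level (N - S) (d - card S). s ^ card U * (L (S \<union> U) (A (N - S - U) g) x)\<^sup>2)"
      using True fin by (intro sum.mono_neutral_right) (auto simp: level_def comp)
    also have "\<dots> = (\<Sum>U\<in>level (N - S) (d - card S). s ^ (d - card S) * (P (N - S) U (L S f) x)\<^sup>2)"
      using True by (intro sum.cong refl) (auto simp: level_def comp)
    finally show ?thesis using True by simp
  qed (simp add: comp)
  then show ?thesis
    unfolding g_def[symmetric] Q_def using fin
    by (auto simp: D_eq_sum A_sum A_zero sum_distrib_left)
qed

section \<open>Weights of Laplacians and the moment bound\<close>

lemma D_nonneg:
  assumes "N \<subseteq> I" "x \<in> C"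
  shows "0 \<le> D N d f x"
  unfolding D_def using assms by (intro A_nonneg) auto

text \<open>By \<open>P_Un\<close> the components of \<open>L S f\<close> at level d - |S|
  correspond to the sets T = S \<union> U of size d; averaging over \<open>S\<close> too completes
  the average to all of \<open>N\<close>.\<close>

lemma A_D_restrict:
  assumes N: "finite N" "S \<subseteq> N" and d: "card S \<le> d"
  shows "A S (D (N - S) (d - card S) (L S f)) x =
    (\<Sum>T\<in>{T \<in> level N d. S \<subseteq> T}. A N (\<lambda>x. (P N T f x)\<^sup>2) x)"
proof -
  have fin: "finite S" "finite (N - S)" using N finite_subset by auto
  have "A S (D (N - S) (d - card S) (L S f)) x =
     (\<Sum>U\<in>level (N - S) (d - card S). A (S \<union> (N - S)) (\<lambda>x. (P (N - S) U (L S f) x)\<^sup>2) x)"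
    using fin by (simp add: D_eq_sum A_sum' A_A)
  also have "S \<union> (N - S) = N" using N by auto
  also have "(\<Sum>U\<in>level (N - S) (d - card S). A N (\<lambda>x. (P (N - S) U (L S f) x)\<^sup>2) x) =
     (\<Sum>T\<in>{T \<in> level N d. S \<subseteq> T}. A N (\<lambda>x. (P N T f x)\<^sup>2) x)"
  proof (rule sum.reindex_bij_witness[where j = "\<lambda>U. S \<union> U" and i = "\<lambda>T. T - S"])
    fix U assume U: "U \<in> level (N - S) (d - card S)"
    then have "finite U" "S \<inter> U = {}" using fin finite_subset[of U "N - S"] by (auto simp: level_def)
    then show "S \<union> U \<in> {T \<in> level N d. S \<subseteq> T}"
      using U N d fin by (auto simp: level_def card_Un_disjoint)
    show "A N (\<lambda>x. (P N (S \<union> U) f x)\<^sup>2) x = A N (\<lambda>x. (P (N - S) U (L S f) x)\<^sup>2) x"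
      using U N by (simp add: P_Un level_def)
  next
    fix T assume "T \<in> {T \<in> level N d. S \<subseteq> T}"
    then show "T - S \<in> level (N - S) (d - card S)"
      using fin by (auto simp: level_def card_Diff_subset)
  qed (auto simp: level_def)
  finally show ?thesis .
qed

text \<open>After exchanging the sums, each \<open>T\<close> of size d is counted once for every
  subset \<open>S\<close>, and the binomial theorem evaluates the coefficients.\<close>

lemma sum_A_D_restrict:
  assumes N: "finite N"
  shows "(\<Sum>S\<in>{S \<in> Pow N. card S \<le> d}. a ^ card S * b ^ (d - card S) *
      A S (D (N - S) (d - card S) (L S f)) x) = (a + b) ^ d * D N d f x"
proof -
  have "(\<Sum>S\<in>{S \<in> Pow N. card S \<le> d}. a ^ card S * b ^ (d - card S) *
      A S (D (N - S) (d - card S) (L S f)) x) =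
    (\<Sum>S\<in>{S \<in> Pow N. card S \<le> d}. \<Sum>T\<in>{T \<in> level N d. S \<subseteq> T}.
      a ^ card S * b ^ (d - card S) * A N (\<lambda>x. (P N T f x)\<^sup>2) x)"
    using N by (intro sum.cong refl) (auto simp: A_D_restrict sum_distrib_left)
  also have "\<dots> = (\<Sum>T\<in>level N d. \<Sum>S\<in>{S \<in> {S \<in> Pow N. card S \<le> d}. S \<subseteq> T}.
      a ^ card S * b ^ (d - card S) * A N (\<lambda>x. (P N T f x)\<^sup>2) x)"
    using N finite_level[OF N] by (intro sum.swap_restrict) auto
  also have "\<dots> = (\<Sum>T\<in>level N d. (a + b) ^ d * A N (\<lambda>x. (P N T f x)\<^sup>2) x)"
  proof (intro sum.cong refl)
    fix T assume T: "T \<in> level N d"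
    then have "finite T" "card T = d" using N finite_subset by (auto simp: level_def)
    then have "{S \<in> {S \<in> Pow N. card S \<le> d}. S \<subseteq> T} = Pow T"
      using T card_mono[of T] by (auto simp: level_def)
    then show "(\<Sum>S\<in>{S \<in> {S \<in> Pow N. card S \<le> d}. S \<subseteq> T}.
        a ^ card S * b ^ (d - card S) * A N (\<lambda>x. (P N T f x)\<^sup>2) x) =
        (a + b) ^ d * A N (\<lambda>x. (P N T f x)\<^sup>2) x"
      using sum_Pow_powers[OF \<open>finite T\<close>, of a b] \<open>card T = d\<close>
      by (simp add: sum_distrib_right[symmetric])
  qed
  also have "\<dots> = (a + b) ^ d * D N d f x"
    using N by (simp add: D_eq_sum sum_distrib_left)
  finally show ?thesis .
qed

text \<open>In the hypercontractive bound each m-th power of a fibre weight is split into m - 1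
  factors, bounded uniformly by \<open>bound\<close>, and one factor kept exact. What remains is
  linear in the weights and is summed by \<open>sum_A_D_restrict\<close>.\<close>

lemma level_moment_bound:
  fixes m :: nat
  assumes m: "2 \<le> m" and N: "finite N" "N \<subseteq> I" and x: "x \<in> C" and \<rho>: "0 \<le> \<rho>"
    and X: "X = D N d f x"
    and bound: "\<And>S y. S \<subseteq> N \<Longrightarrow> S \<noteq> {} \<Longrightarrow> card S \<le> d \<Longrightarrow> y \<in> C \<Longrightarrow>
        D (N - S) (d - card S) (L S f) y \<le> X * \<rho> ^ card S"
  shows "A N (\<lambda>x. (\<Sum>T\<in>level N d. P N T f x) ^ (2 * m)) x \<le>
     X ^ m * ((4 * real m ^ 2) ^ m * \<rho> ^ (m - 1) + (6 * real m) ^ m) ^ d"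
proof -
  define B where "B = (4 * real m ^ 2) ^ m"
  define s where "s = 6 * real m"
  have B0: "0 \<le> B" and s0: "0 \<le> s" by (auto simp: B_def s_def)
  have X0: "0 \<le> X" unfolding X using N x by (rule_tac D_nonneg)
  have "A N (\<lambda>x. (\<Sum>T\<in>level N d. P N T f x) ^ (2 * m)) x \<le>
      (\<Sum>S\<in>Pow N. B ^ card S * A S (\<lambda>x. Q s N S (\<lambda>x. \<Sum>T\<in>level N d. P N T f x) x ^ m) x)"
    unfolding B_def using m s_def N x by (rule hypercontractivity)
  also have "\<dots> = (\<Sum>S\<in>{S \<in> Pow N. card S \<le> d}. B ^ card S *
      A S (\<lambda>x. (s ^ (d - card S) * D (N - S) (d - card S) (L S f) x) ^ m) x)"
    using N m by (intro sum.mono_neutral_cong_right) (auto simp: Q_level A_zero power_0_left)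
  also have "\<dots> \<le> (\<Sum>S\<in>{S \<in> Pow N. card S \<le> d}. B ^ card S *
      ((s ^ m) ^ (d - card S) * ((X * \<rho> ^ card S) ^ (m - 1) * A S (D (N - S) (d - card S) (L S f)) x)))"
  proof (intro sum_mono mult_left_mono)
    fix S assume "S \<in> {S \<in> Pow N. card S \<le> d}"
    then have S: "S \<subseteq> N" "card S \<le> d" by auto
    define F where "F = D (N - S) (d - card S) (L S f)"
    have F0: "0 \<le> F y" if "y \<in> C" for y
      unfolding F_def using that N by (intro D_nonneg) auto
    have Fm: "F y ^ m \<le> (X * \<rho> ^ card S) ^ (m - 1) * F y" if "y \<in> C" "F y \<le> X * \<rho> ^ card S" for y
    proof -
      have "F y ^ m = F y ^ (m - 1) * F y" using m by (cases m) auto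
      also have "\<dots> \<le> (X * \<rho> ^ card S) ^ (m - 1) * F y"
        using that F0 by (intro mult_right_mono power_mono) auto
      finally show ?thesis .
    qed
    have "A S (\<lambda>x. F x ^ m) x \<le> A S (\<lambda>x. (X * \<rho> ^ card S) ^ (m - 1) * F x) x"
    \<comment> \<open>For the empty set the average is evaluation at \<open>x\<close>, where the
      weight equals \<open>X\<close> by definition; otherwise \<open>bound\<close> controls it on
      all of \<open>C\<close>.\<close>
    proof (cases "S = {}")
      case True
      then show ?thesis using Fm[OF x] by (simp add: F_def X)
    next
      case False
      then show ?thesis
        using S N x bound by (intro A_mono Fm) (auto simp: F_def)
    qed
    also have "\<dots> = (X * \<rho> ^ card S) ^ (m - 1) * A S F x" by (simp add: A_cmult)
    finally have "A S (\<lambda>x. F x ^ m) x \<le> (X * \<rho> ^ card S) ^ (m - 1) * A S F x" .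
    then show "A S (\<lambda>x. (s ^ (d - card S) * F x) ^ m) x \<le>
        (s ^ m) ^ (d - card S) * ((X * \<rho> ^ card S) ^ (m - 1) * A S F x)"
      using s0 by (simp add: power_mult_distrib A_cmult mult_left_mono power_mult[symmetric] mult.commute[of m])
  qed (use B0 in auto)
  also have "\<dots> = X ^ (m - 1) * (\<Sum>S\<in>{S \<in> Pow N. card S \<le> d}.
      (B * \<rho> ^ (m - 1)) ^ card S * (s ^ m) ^ (d - card S) * A S (D (N - S) (d - card S) (L S f)) x)"
    unfolding sum_distrib_left
    by (intro sum.cong refl)
       (simp add: power_mult_distrib power_mult[symmetric] mult.commute[of "m - Suc 0"] mult_ac)
  also have "\<dots> = X ^ (m - 1) * ((B * \<rho> ^ (m - 1) + s ^ m) ^ d * X)"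
    unfolding sum_A_D_restrict[OF N(1)] X ..
  also have "\<dots> = X ^ m * (B * \<rho> ^ (m - 1) + s ^ m) ^ d"
    using m by (cases m) auto
  finally show ?thesis unfolding B_def s_def .
qed

lemma A_Hoelder:
  assumes "finite N"
  shows "(A N (\<lambda>x. f x * g x) x) ^ (2 * Suc k) \<le>
    (A N (\<lambda>x. \<bar>f x\<bar>) x) ^ (2 * k) * (A N (\<lambda>x. (f x)\<^sup>2) x * A N (\<lambda>x. g x ^ (2 * Suc k)) x)"
  unfolding A_def using finite_cube[OF assms] wt_nonneg by (rule interpolated_Hoelder)

text \<open>The induction varies \<open>N\<close>, \<open>f\<close>, \<gamma> and the base point,
  while \<open>R\<close> and \<open>l\<close> stay fixed. Both hypotheses pass from \<open>f\<close>
  to \<open>L S f\<close> on \<open>N - S\<close> with \<gamma> multiplied by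
  \<open>R ^ card S\<close>, because L_S' L_S = L_(S' \<union> S) for disjoint sets.\<close>

lemma level_inequality:
  assumes "R \<ge> 1" "4 * real d \<le> l" "finite N" "N \<subseteq> I" "x \<in> C"
    and L1: "\<And>S y. S \<subseteq> N \<Longrightarrow> card S \<le> d \<Longrightarrow> y \<in> C \<Longrightarrow> A (N - S) (\<lambda>x. \<bar>L S f x\<bar>) y \<le> R ^ card S * \<gamma>"
    and L2: "\<And>S y. S \<subseteq> N \<Longrightarrow> card S \<le> d \<Longrightarrow> y \<in> C \<Longrightarrow>
       A (N - S) (\<lambda>x. (L S f x)\<^sup>2) y \<le> (R ^ card S * \<gamma>)\<^sup>2 * exp l"
  shows "D N d f x \<le> \<gamma>\<^sup>2 * (550 * R\<^sup>2 * l / real d) ^ d"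
  using assms(2-)
proof (induction d arbitrary: N f \<gamma> x rule: less_induct)
  case (less d)
  note N = less.prems(2,3) and x = less.prems(4) and L1 = less.prems(5) and L2 = less.prems(6)
  have l1: "A N (\<lambda>x. \<bar>f x\<bar>) x \<le> \<gamma>" using L1[of "{}" x] x by simp
  have l2: "A N (\<lambda>x. (f x)\<^sup>2) x \<le> \<gamma>\<^sup>2 * exp l" using L2[of "{}" x] x by simp
  have A0: "0 \<le> A N (\<lambda>x. \<bar>f x\<bar>) x" using N x by (intro A_nonneg) auto
  then have \<gamma>: "0 \<le> \<gamma>" using l1 by linarith
  show ?case
  proof (cases "d = 0")
    case True
    \<comment> \<open>At level 0 the only component is the mean, and the junk quotient
      \<open>l / 0\<close> is raised to the power 0.\<close>
    have "level N 0 = {{}}" using finite_subset[OF _ N(1)] by (auto simp: level_def)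
    then have "D N d f x = (A N f x)\<^sup>2"
      using True N by (simp add: D_def P_def power2_eq_square A_mult_fixed A_A)
    also have "\<dots> \<le> \<gamma>\<^sup>2"
      using A_abs[OF N(2) x, of f] l1 by (metis abs_le_square_iff abs_of_nonneg order.trans \<gamma>)
    finally show ?thesis using True by simp
  next
    case False
    then have d: "d > 0" by simp
    then have l0: "l > 0" using less.prems(1) by auto
    define W where "W = \<gamma>\<^sup>2 * (550 * R\<^sup>2 * l / real d) ^ d"
    have W0: "0 \<le> W" unfolding W_def using l0 \<gamma> by (intro mult_nonneg_nonneg zero_le_power) auto
    define X where "X = D N d f x"
    define \<rho> where "\<rho> = 3 * real d / (550 * l)"
    show ?thesis
    proof (rule ccontr)
      \<comment> \<open>Under this assumption the bound \<open>W\<close> obtained from the induction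
        hypothesis may be replaced by \<open>X\<close>, so that all fibre weights are measured
        against \<open>X\<close> itself.\<close>
      assume "\<not> ?thesis"
      then have XW: "W < X" by (simp add: W_def X_def)
      with W0 have X0: "X > 0" by simp
      \<comment> \<open>The exponent m = k + 2 is the integer part of l / (2 d); 4 d <= l makes it
        at least 2.\<close>
      obtain k where k: "real (k + 2) \<le> l / (2 * real d)" "l / (2 * real d) < real (k + 2) + 1"
      proof -
        have "2 \<le> l / (2 * real d)" using less.prems(1) d by (simp add: field_simps)
        then have "2 \<le> nat \<lfloor>l / (2 * real d)\<rfloor>" by linarith
        then obtain k where "nat \<lfloor>l / (2 * real d)\<rfloor> = k + 2" by (metis add.commute le_Suc_ex)
        then show ?thesis using that[of k] \<open>2 \<le> l / _\<close> by linarith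
      qed
      define m where "m = k + 2"
      have m: "2 \<le> m" "real m \<le> l / (2 * real d)" "l / (2 * real d) < real m + 1"
        using k by (simp_all add: m_def)
      have "D (N - S) (d - card S) (L S f) y \<le> X * \<rho> ^ card S"
        if S: "S \<subseteq> N" "S \<noteq> {}" "card S \<le> d" and y: "y \<in> C" for S y
      proof -
        have fS: "finite S" using S N finite_subset by auto
        have "D (N - S) (d - card S) (L S f) y \<le>
            (R ^ card S * \<gamma>)\<^sup>2 * (550 * R\<^sup>2 * l / real (d - card S)) ^ (d - card S)"
        proof (rule less.IH)
          show "d - card S < d" using d S fS by (simp add: card_gt_0_iff)
          show "4 * real (d - card S) \<le> l" using less.prems(1) by linarith
          show "finite (N - S)" "N - S \<subseteq> I" "y \<in> C" using N y by auto
          fix S' z assume S': "S' \<subseteq> N - S" "card S' \<le> d - card S" and z: "z \<in> C"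
          have fin: "finite S'" using S' N finite_subset[of S' "N - S"] by auto
          have dis: "S' \<inter> S = {}" using S' by auto
          have cU: "card (S' \<union> S) = card S' + card S"
            using fin fS dis by (rule card_Un_disjoint)
          have "S' \<union> S \<subseteq> N" "card (S' \<union> S) \<le> d" and diff: "N - S - S' = N - (S' \<union> S)"
            using S S' cU by auto
          note prem = this(1,2)
          show "A (N - S - S') (\<lambda>x. \<bar>L S' (L S f) x\<bar>) z \<le> R ^ card S' * (R ^ card S * \<gamma>)"
            using L1[OF prem z] unfolding diff L_L[OF fin fS dis] by (simp add: cU power_add mult.assoc)
          show "A (N - S - S') (\<lambda>x. (L S' (L S f) x)\<^sup>2) z \<le> (R ^ card S' * (R ^ card S * \<gamma>))\<^sup>2 * exp l"
            using L2[OF prem z] unfolding diff L_L[OF fin fS dis] by (simp add: cU power_add mult.assoc)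
        qed
        also have "\<dots> \<le> W * \<rho> ^ card S"
          unfolding W_def \<rho>_def using S d l0 assms(1) by (intro shifted_level_bound) auto
        also have "\<dots> \<le> X * \<rho> ^ card S"
          using XW l0 by (intro mult_right_mono) (auto simp: \<rho>_def)
        finally show ?thesis .
      qed
      then have mom: "A N (\<lambda>x. (\<Sum>T\<in>level N d. P N T f x) ^ (2 * m)) x \<le>
          X ^ m * ((4 * real m ^ 2) ^ m * \<rho> ^ (m - 1) + (6 * real m) ^ m) ^ d"
        using N x l0 X_def by (intro level_moment_bound) (auto simp: \<rho>_def m_def)
      have sm: "Suc (m - 1) = m" by (simp add: m_def)
      have A02: "0 \<le> A N (\<lambda>x. (f x)\<^sup>2) x"
        using N x by (intro A_nonneg) auto
      have A0m: "0 \<le> A N (\<lambda>x. (\<Sum>T\<in>level N d. P N T f x) ^ (2 * m)) x"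
        using N x by (intro A_nonneg zero_le_even_power) auto
      have "X ^ (2 * m) = (A N (\<lambda>x. f x * (\<Sum>T\<in>level N d. P N T f x)) x) ^ (2 * Suc (m - 1))"
        using N by (simp add: X_def D_eq_inner m_def)
      also have "\<dots> \<le> (A N (\<lambda>x. \<bar>f x\<bar>) x) ^ (2 * (m - 1)) * (A N (\<lambda>x. (f x)\<^sup>2) x *
          A N (\<lambda>x. (\<Sum>T\<in>level N d. P N T f x) ^ (2 * Suc (m - 1))) x)"
        using N(1) by (rule A_Hoelder)
      also have "\<dots> \<le> \<gamma> ^ (2 * (m - 1)) * ((\<gamma>\<^sup>2 * exp l) *
          (X ^ m * ((4 * real m ^ 2) ^ m * \<rho> ^ (m - 1) + (6 * real m) ^ m) ^ d))"
        using mom l1 l2 A0 \<gamma> A02 A0m unfolding sm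
        by (intro mult_mono power_mono mult_nonneg_nonneg) auto
      also have "\<dots> = \<gamma> ^ (2 * m) * exp l * (X ^ m * ((4 * real m ^ 2) ^ m * \<rho> ^ (m - 1) + (6 * real m) ^ m) ^ d)"
        by (simp add: m_def power2_eq_square)
      finally have "X ^ (2 * m) \<le> \<gamma> ^ (2 * m) * exp l *
          (X ^ m * ((4 * real m ^ 2) ^ m * \<rho> ^ (m - 1) + (6 * real m) ^ m) ^ d)" .
      from moment_self_bound[OF m d X0 \<gamma> l0 this[unfolded \<rho>_def]]
      have "X \<le> \<gamma>\<^sup>2 * (162 * l / real d) ^ d" .
      \<comment> \<open>The improved constant 162 is below 550 and R >= 1, which contradicts
        \<open>W < X\<close>.\<close>
      also have "\<dots> \<le> W"
      proof -
        have "162 * l \<le> 550 * R\<^sup>2 * l"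
          using l0 one_le_power[OF assms(1), of 2] by (intro mult_right_mono) auto
        then show ?thesis
          unfolding W_def using l0 by (intro mult_left_mono power_mono divide_right_mono) auto
      qed
      finally show False using XW by simp
    qed
  qed
qed

section \<open>Boolean functions\<close>

lemma EopS_eq_A:
  assumes "finite S"
  shows "EopS Om mu S = A S"
proof
  fix g
  have "foldr (\<lambda>i h. E i \<circ> h) xs id g = A (set xs) g" if "distinct xs" for xs
    using that by (induction xs) (auto simp: A_insert)
  from this[of "sorted_list_of_set S"] show "EopS Om mu S g = A S g"
    using assms by (simp add: EopS_def)
qed

lemma LopS_eq_L:
  assumes "finite S"
  shows "LopS Om mu S = L S"
proof
  fix g
  have "foldr (\<lambda>i h. Lop Om mu i \<circ> h) xs id g = L (set xs) g" if "distinct xs" for xs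
    using that by (induction xs) (auto simp: L_insert Lop_def)
  from this[of "sorted_list_of_set S"] show "LopS Om mu S g = L S g"
    using assms by (simp add: LopS_def)
qed

text \<open>\<open>L S f\<close> is dominated by the sum of all averages \<open>A U f\<close> with U
  \<subseteq> S. Averaging over \<open>I - S\<close> leaves only the coordinates in
  \<open>S - U\<close> fixed, where \<open>global\<close> applies, and the binomial theorem sums the
  bounds to \<open>(1 + r) ^ card S\<close>.\<close>

lemma L_bounds:
  assumes f: "\<And>z. z \<in> C \<Longrightarrow> f z \<in> {0, 1}" and S: "S \<subseteq> I" and y: "y \<in> C"
    and r: "1 \<le> r" and \<alpha>: "0 \<le> \<alpha>"
    and global: "\<And>U y. U \<subseteq> S \<Longrightarrow> y \<in> C \<Longrightarrow> A (I - U) f y \<le> r ^ card U * \<alpha>"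
  shows "A (I - S) (\<lambda>x. \<bar>L S f x\<bar>) y \<le> (1 + r) ^ card S * \<alpha>"
    and "A (I - S) (\<lambda>x. (L S f x)\<^sup>2) y \<le> ((1 + r) ^ card S)\<^sup>2 * \<alpha>"
proof -
  have fin: "finite S" "finite (I - S)" using S fin_I finite_subset by auto
  have fU: "finite U" "U \<subseteq> I" if "U \<in> Pow S" for U using that S fin finite_subset by auto
  have f01: "0 \<le> f z" "f z \<le> 1" if "z \<in> C" for z using f[OF that] by auto
  have AU: "0 \<le> A U f z" "A U f z \<le> 1" if "U \<in> Pow S" "z \<in> C" for U z
  proof -
    show "0 \<le> A U f z" using that fU f01 by (intro A_nonneg) auto
    have "A U f z \<le> A U (\<lambda>_. 1) z" using that fU f01 by (intro A_mono) auto
    then show "A U f z \<le> 1" using fU[OF that(1)] by (simp add: A_const)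
  qed
  have L_le: "\<bar>L S f z\<bar> \<le> (\<Sum>U\<in>Pow S. A U f z)" if "z \<in> C" for z
    unfolding L_def using AU that by (intro order.trans[OF sum_abs] sum_mono) (simp add: abs_mult)
  \<comment> \<open>Each of the 2^|S| averages lies in [0, 1] because \<open>f\<close> is Boolean,
    and 2 <= 1 + r. This trades one factor of the square for
    \<open>(1 + r) ^ card S\<close>.\<close>
  have L_le2: "\<bar>L S f z\<bar> \<le> (1 + r) ^ card S" if "z \<in> C" for z
  proof -
    have "\<bar>L S f z\<bar> \<le> (\<Sum>U\<in>Pow S. 1)"
      using L_le[OF that] AU that by (rule_tac order.trans[OF _ sum_mono]) auto
    also have "\<dots> = 2 ^ card S" using fin by (simp add: card_Pow)
    also have "\<dots> \<le> (1 + r) ^ card S" using r by (intro power_mono) auto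
    finally show ?thesis .
  qed
  have "A (I - S) (\<lambda>x. \<bar>L S f x\<bar>) y \<le> A (I - S) (\<lambda>z. \<Sum>U\<in>Pow S. A U f z) y"
    using y L_le by (intro A_mono) auto
  also have "\<dots> = (\<Sum>U\<in>Pow S. A (I - (S - U)) f y)"
    unfolding A_sum'
  proof (intro sum.cong refl)
    fix U assume U: "U \<in> Pow S"
    then have "(I - S) \<union> U = I - (S - U)" using S by auto
    then show "A (I - S) (A U f) y = A (I - (S - U)) f y" using fU[OF U] fin by (simp add: A_A)
  qed
  also have "\<dots> \<le> (\<Sum>U\<in>Pow S. r ^ card (S - U) * \<alpha>)"
    using y by (intro sum_mono global) auto
  also have "\<dots> = (\<Sum>U\<in>Pow S. 1 ^ card U * r ^ (card S - card U)) * \<alpha>"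
    unfolding sum_distrib_right using fU by (intro sum.cong refl) (simp add: card_Diff_subset)
  also have "\<dots> = (1 + r) ^ card S * \<alpha>"
    using fin by (simp only: sum_Pow_powers)
  finally show 1: "A (I - S) (\<lambda>x. \<bar>L S f x\<bar>) y \<le> (1 + r) ^ card S * \<alpha>" .
  have "A (I - S) (\<lambda>x. (L S f x)\<^sup>2) y \<le> A (I - S) (\<lambda>x. (1 + r) ^ card S * \<bar>L S f x\<bar>) y"
  proof (intro A_mono)
    fix z assume "z \<in> C"
    have "(L S f z)\<^sup>2 = \<bar>L S f z\<bar> * \<bar>L S f z\<bar>" by (simp add: power2_eq_square)
    also have "\<dots> \<le> (1 + r) ^ card S * \<bar>L S f z\<bar>"
      using L_le2[OF \<open>z \<in> C\<close>] by (intro mult_right_mono) auto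
    finally show "(L S f z)\<^sup>2 \<le> (1 + r) ^ card S * \<bar>L S f z\<bar>" .
  qed (use y in auto)
  also have "\<dots> \<le> (1 + r) ^ card S * ((1 + r) ^ card S * \<alpha>)"
    unfolding A_cmult using 1 r by (intro mult_left_mono) auto
  finally show "A (I - S) (\<lambda>x. (L S f x)\<^sup>2) y \<le> ((1 + r) ^ card S)\<^sup>2 * \<alpha>"
    by (simp add: power2_eq_square mult.assoc)
qed

end

theorem mainTheorem3:
  fixes Om :: "'a set" and mu :: "'a \<Rightarrow> real" and n d :: nat
    and f :: "(nat \<Rightarrow> 'a) \<Rightarrow> real" and r :: real
  assumes "fin_prob_space Om mu"
    and "\<forall>x\<in>cube Om {..<n}. f x \<in> {0, 1}"
    and "expect Om mu n f > 0"
    and "r > 1"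
    and "real d \<le> ln (1 / expect Om mu n f) / 4"
    and "\<forall>S. S \<subseteq> {..<n} \<and> card S \<le> d \<longrightarrow>
           (\<forall>x\<in>cube Om S. restr_expect Om mu n f S x \<le> r ^ card S * expect Om mu n f)"
  shows "norm2sq Om mu n (es_level Om mu n f d)
           \<le> (expect Om mu n f)^2 * (2200 * r^2 * ln (1 / expect Om mu n f) / real d) ^ d"
proof -
  interpret product_space Om mu "{..<n}"
    using assms(1) by unfold_locales auto
  define \<alpha> where "\<alpha> = expect Om mu n f"
  define l where "l = ln (1 / \<alpha>)"
  have \<alpha>: "\<alpha> > 0" using assms(3) by (simp add: \<alpha>_def)
  \<comment> \<open>With this \<open>l\<close>, the quantity \<alpha>^2 exp l is just \<alpha>,
    which matches the L^2 bound of \<open>L_bounds\<close> to the hypothesis of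
    \<open>level_inequality\<close>.\<close>
  have exp_l: "exp l = 1 / \<alpha>" using \<alpha> by (simp add: l_def)
  have l: "4 * real d \<le> l" using assms(5) by (simp add: l_def \<alpha>_def)
  have expect_A: "expect Om mu n g = A {..<n} g x" if "x \<in> C" for g x
    unfolding expect_def A_def wt_def
  proof (intro sum.cong refl)
    fix y assume "y \<in> C"
    then have "override_on x y {..<n} = y"
      using that by (auto simp: override_on_def cube_def PiE_def extensional_def fun_eq_iff)
    then show "(\<Prod>i<n. mu (y i)) * g y = (\<Prod>i<n. mu (y i)) * g (override_on x y {..<n})" by simp
  qed
  \<comment> \<open>Fibres are indexed here by full points: the coordinates of \<open>x\<close>
    outside \<open>S\<close> are overwritten by the average.\<close>
  have restr_A: "restr_expect Om mu n f S (restrict x S) = A ({..<n} - S) f x"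
    if "x \<in> C" "S \<subseteq> {..<n}" for x S
    unfolding restr_expect_def A_def wt_def
  proof (intro sum.cong refl)
    fix y assume "y \<in> cube Om ({..<n} - S)"
    then have "(\<lambda>i. if i \<in> S then restrict x S i else y i) = override_on x y ({..<n} - S)"
      using that by (auto simp: override_on_def cube_def PiE_def extensional_def fun_eq_iff)
    then show "(\<Prod>i\<in>{..<n} - S. mu (y i)) * f (\<lambda>i. if i \<in> S then restrict x S i else y i) =
        (\<Prod>i\<in>{..<n} - S. mu (y i)) * f (override_on x y ({..<n} - S))" by simp
  qed
  have global: "A ({..<n} - S) f x \<le> r ^ card S * \<alpha>" if "x \<in> C" "S \<subseteq> {..<n}" "card S \<le> d" for x S
  proof -
    have "restrict x S \<in> cube Om S" using that by (auto simp: cube_def)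
    then show ?thesis using assms(6)[rule_format, of S "restrict x S"] that restr_A[of x S] by (simp add: \<alpha>_def)
  qed
  have bounds: "A ({..<n} - S) (\<lambda>x. \<bar>L S f x\<bar>) y \<le> (1 + r) ^ card S * \<alpha>"
    "A ({..<n} - S) (\<lambda>x. (L S f x)\<^sup>2) y \<le> ((1 + r) ^ card S * \<alpha>)\<^sup>2 * exp l"
    if S: "S \<subseteq> {..<n}" "card S \<le> d" and y: "y \<in> C" for S y
  proof -
    have gl: "A ({..<n} - U) f z \<le> r ^ card U * \<alpha>" if "U \<subseteq> S" "z \<in> C" for U z
      using that S card_mono[of S U] finite_subset[OF S(1)] by (intro global) auto
    have f: "f z \<in> {0, 1}" if "z \<in> C" for z using assms(2) that by blast
    have "1 \<le> r" "0 \<le> \<alpha>" using assms(4) \<alpha> by auto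
    note b = L_bounds[OF f S(1) y this gl]
    show "A ({..<n} - S) (\<lambda>x. \<bar>L S f x\<bar>) y \<le> (1 + r) ^ card S * \<alpha>" by (rule b(1))
    have "((1 + r) ^ card S * \<alpha>)\<^sup>2 * exp l = ((1 + r) ^ card S)\<^sup>2 * \<alpha>"
      using \<alpha> by (simp add: exp_l power2_eq_square)
    then show "A ({..<n} - S) (\<lambda>x. (L S f x)\<^sup>2) y \<le> ((1 + r) ^ card S * \<alpha>)\<^sup>2 * exp l"
      using b(2) by simp
  qed
  \<comment> \<open>Averages over all coordinates are constant, so any base point will do; one
    exists because \<open>Om\<close> is nonempty.\<close>
  obtain x where x: "x \<in> C"
  proof -
    obtain a where "a \<in> Om" using Om_ne by auto
    then show ?thesis using that[of "\<lambda>i\<in>{..<n}. a"] by (auto simp: cube_def)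
  qed
  have es: "es_level Om mu n f d = (\<lambda>x. \<Sum>T\<in>level {..<n} d. P {..<n} T f x)"
    unfolding es_level_def level_def es_comp_def P_def
    by (intro ext sum.cong refl) (auto simp: EopS_eq_A LopS_eq_L finite_subset)
  have "norm2sq Om mu n (es_level Om mu n f d) = D {..<n} d f x"
    unfolding norm2sq_def expect_A[OF x] D_def es ..
  \<comment> \<open>Here R = 1 + r, and 1 + r <= 2 r then turns 550 into 4 * 550 = 2200.\<close>
  also have "\<dots> \<le> \<alpha>\<^sup>2 * (550 * (1 + r)\<^sup>2 * l / real d) ^ d"
    using assms(4) l x bounds by (intro level_inequality) auto
  also have "\<dots> \<le> \<alpha>\<^sup>2 * (2200 * r\<^sup>2 * l / real d) ^ d"
  proof -
    have "(1 + r)\<^sup>2 \<le> (2 * r)\<^sup>2" using assms(4) by (intro power_mono) auto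
    then have "550 * (1 + r)\<^sup>2 * l \<le> 2200 * r\<^sup>2 * l"
      using l by (intro mult_right_mono) (auto simp: power_mult_distrib)
    then show ?thesis
      using l by (intro mult_left_mono power_mono divide_right_mono) auto
  qed
  finally show ?thesis by (simp add: \<alpha>_def l_def)
qed

end
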